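(* Let $v_k\in V$ be of weight $\mathrm{wt}(v_k)$ for $k=1,\ldots,n$. Then for all $\gamma=\begin{pmatrix}a&b\\c&d\end{pmatrix}\in\mathrm{SL}_2(\mathbb C)$, $$Z^{(0)}(v_1,y_1;\ldots;v_n,y_n)=Z^{(0)}\left(\ldots;e^{-c(cy_k+d)L(1)}(cy_k+d)^{-2\mathrm{wt}(v_k)}v_k,\gamma y_k;\ldots\right),$$ where on the right-hand side every $(v_k,y_k)$, $k=1,\ldots,n$, is replaced as indicated and $\gamma y=\frac{ay+b}{cy+d}$.
   Context: $V=(V,Y,\mathbf 1,\omega)$ is a simple vertex operator algebra over $\mathbb C$ of strong CFT type ($V=\bigoplus_{n\ge0}V_n$, $\dim V_n<\infty$, $V_0=\mathbb C\mathbf 1$, $L(1)V_1=0$), isomorphic to its contragredient module $V'$. $Y(\omega,z)=\sum_nL(n)z^{-n-2}$. $\langle\cdot,\cdot\rangle$ is the unique non-degenerate invariant bilinear form on $V$ with $\langle\mathbf 1,\mathbf 1\rangle=1$: $\langle Y(u,z)v,w\rangle=\langle v,Y(e^{zL(1)}(-z^{-2})^{L(0)}u,z^{-1})w\rangle$. The genus zero $n$-point function is $Z^{(0)}(v_1,y_1;\ldots;v_n,y_n)=\langle\mathbf 1,Y(v_1,y_1)\cdots Y(v_n,y_n)\mathbf 1\rangle$, extended (from $|y_1|>\cdots>|y_n|$) to a rational function of $y_1,\ldots,y_n$, and multilinearly in the vectors. *)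

theory Defs
  imports "HOL-Analysis.Analysis" "HOL-Library.Groups_Big_Fun"
begin

text \<open>
  The underlying complex vector space is a whole type \<open>'v\<close> with scalar multiplication
  \<open>smul\<close>. The state-field map is given by its modes: \<open>Y u n v\<close> is the vector
  \<open>u\<^sub>n v\<close> in \<open>Y(u,z)v = \<Sum>\<^sub>n u\<^sub>n v z\<^bsup>-n-1\<^esup>\<close>.
  The constant \<open>Sum_any\<close> is the sum over the support of a family; every support that
  occurs below is finite in a vertex operator algebra.
\<close>

definition vir :: "('v \<Rightarrow> int \<Rightarrow> 'v \<Rightarrow> 'v) \<Rightarrow> 'v \<Rightarrow> int \<Rightarrow> 'v \<Rightarrow> 'v"
  where "vir Y \<omega> n = Y \<omega> (n + 1)"

definition wt_space ::
    "(complex \<Rightarrow> 'v \<Rightarrow> 'v) \<Rightarrow> ('v \<Rightarrow> int \<Rightarrow> 'v \<Rightarrow> 'v) \<Rightarrow> 'v \<Rightarrow> int \<Rightarrow> 'v set"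
  where "wt_space smul Y \<omega> k = {v. vir Y \<omega> 0 v = smul (of_int k) v}"

text \<open>
  Assumption \<open>jacobi\<close> is the Jacobi identity, one coefficient at a time (Borcherds' identity).
  In \<open>grading\<close>, directness of the sum is automatic because the weight spaces are eigenspaces
  of \<open>L(0)\<close> for different eigenvalues.
\<close>

locale vertex_operator_algebra = vector_space smul
  for smul :: "complex \<Rightarrow> 'v::ab_group_add \<Rightarrow> 'v" +
  fixes Y :: "'v \<Rightarrow> int \<Rightarrow> 'v \<Rightarrow> 'v" and vac :: 'v and \<omega> :: 'v
  assumes linear_field: "\<And>n v. Vector_Spaces.linear smul smul (\<lambda>u. Y u n v)"
    and linear_mode: "\<And>u n. Vector_Spaces.linear smul smul (Y u n)"
    and truncation: "\<And>u v. \<exists>N. \<forall>n\<ge>N. Y u n v = 0"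
    and vacuum: "\<And>n v. Y vac n v = (if n = -1 then v else 0)"
    and creation: "\<And>v n. n \<ge> 0 \<Longrightarrow> Y v n vac = 0"
    and creation': "\<And>v. Y v (-1) vac = v"
    and jacobi: "\<And>u v w l m n.
        Sum_any (\<lambda>i::nat. smul ((-1) ^ i * (of_int l gchoose i))
          (Y u (l + m - int i) (Y v (n + int i) w)))
      - Sum_any (\<lambda>i::nat. smul ((-1) ^ i * (-1) powi l * (of_int l gchoose i))
          (Y v (l + n - int i) (Y u (m + int i) w)))
      = Sum_any (\<lambda>i::nat. smul (of_int m gchoose i)
          (Y (Y u (l + int i) v) (m + n - int i) w))"
    and virasoro: "\<exists>cc::complex. \<forall>m n v.
        vir Y \<omega> m (vir Y \<omega> n v) - vir Y \<omega> n (vir Y \<omega> m v)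
      = smul (of_int (m - n)) (vir Y \<omega> (m + n) v)
        + (if m + n = 0 then smul (of_int (m ^ 3 - m) / 12 * cc) v else 0)"
    and derivative: "\<And>u n v. Y (vir Y \<omega> (-1) u) n v = smul (- of_int n) (Y u (n - 1) v)"
    and grading: "span (\<Union>k. wt_space smul Y \<omega> k) = UNIV"
    and finite_dim: "\<And>k. \<exists>B. finite B \<and> wt_space smul Y \<omega> k = span B"
    and bounded_below: "\<exists>N. \<forall>k<N. wt_space smul Y \<omega> k = {0}"

definition strong_cft_type ::
    "(complex \<Rightarrow> 'v \<Rightarrow> 'v::ab_group_add) \<Rightarrow> ('v \<Rightarrow> int \<Rightarrow> 'v \<Rightarrow> 'v) \<Rightarrow> 'v \<Rightarrow> 'v \<Rightarrow> bool"
  where "strong_cft_type smul Y vac \<omega> \<longleftrightarrow>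
      (\<forall>k<0. wt_space smul Y \<omega> k = {0}) \<and>
      wt_space smul Y \<omega> 0 = range (\<lambda>a. smul a vac) \<and>
      (\<forall>v \<in> wt_space smul Y \<omega> 1. vir Y \<omega> 1 v = 0)"

text \<open>
  Simplicity is irreducibility of the adjoint module. Its submodules are the two-sided ideals,
  by skew-symmetry and stability under \<open>L(-1)\<close>.
\<close>

definition simple_voa ::
    "(complex \<Rightarrow> 'v \<Rightarrow> 'v::ab_group_add) \<Rightarrow> ('v \<Rightarrow> int \<Rightarrow> 'v \<Rightarrow> 'v) \<Rightarrow> 'v \<Rightarrow> bool"
  where "simple_voa smul Y vac \<longleftrightarrow> vac \<noteq> 0 \<and>
      (\<forall>I. module.subspace smul I \<and> (\<forall>u n. \<forall>v\<in>I. Y u n v \<in> I) \<longrightarrow> I = {0} \<or> I = UNIV)"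

definition exp_L1 ::
    "(complex \<Rightarrow> 'v \<Rightarrow> 'v::ab_group_add) \<Rightarrow> ('v \<Rightarrow> int \<Rightarrow> 'v \<Rightarrow> 'v) \<Rightarrow> 'v \<Rightarrow> complex \<Rightarrow> 'v \<Rightarrow> 'v"
  where "exp_L1 smul Y \<omega> x v = Sum_any (\<lambda>j::nat. smul (x ^ j / fact j) ((vir Y \<omega> 1 ^^ j) v))"

text \<open>
  For \<open>u\<close> of weight \<open>k\<close>, the operator \<open>opp_mode smul Y \<omega> k u n\<close> is the coefficient
  of \<open>z\<^bsup>-n-1\<^esup>\<close> in \<open>Y(e\<^bsup>zL(1)\<^esup> (-z\<^bsup>-2\<^esup>)\<^bsup>L(0)\<^esup> u, z\<^bsup>-1\<^esup>)
  = (-1)\<^bsup>k\<^esup> \<Sum>\<^sub>j\<^sub>,\<^sub>m (1/j!) (L(1)\<^bsup>j\<^esup> u)\<^sub>m z\<^bsup>j-2k+m+1\<^esup>\<close>.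
  The operator \<open>(-z\<^bsup>-2\<^esup>)\<^bsup>L(0)\<^esup>\<close> is defined on homogeneous vectors and extended
  linearly, so conditions involving it are imposed for homogeneous \<open>u\<close> only.
\<close>

definition opp_mode ::
    "(complex \<Rightarrow> 'v \<Rightarrow> 'v::ab_group_add) \<Rightarrow> ('v \<Rightarrow> int \<Rightarrow> 'v \<Rightarrow> 'v) \<Rightarrow> 'v \<Rightarrow>
      int \<Rightarrow> 'v \<Rightarrow> int \<Rightarrow> 'v \<Rightarrow> 'v"
  where "opp_mode smul Y \<omega> k u n w =
      Sum_any (\<lambda>j::nat. smul ((-1) powi k / fact j)
        (Y ((vir Y \<omega> 1 ^^ j) u) (2 * k - n - int j - 2) w))"

definition restricted_dual ::
    "(complex \<Rightarrow> 'v \<Rightarrow> 'v::ab_group_add) \<Rightarrow> ('v \<Rightarrow> int \<Rightarrow> 'v \<Rightarrow> 'v) \<Rightarrow> 'v \<Rightarrow> ('v \<Rightarrow> complex) set"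
  where "restricted_dual smul Y \<omega> =
      {f. Vector_Spaces.linear smul (*) f \<and> finite {k. \<exists>v \<in> wt_space smul Y \<omega> k. f v \<noteq> 0}}"

definition contragredient_mode ::
    "(complex \<Rightarrow> 'v \<Rightarrow> 'v::ab_group_add) \<Rightarrow> ('v \<Rightarrow> int \<Rightarrow> 'v \<Rightarrow> 'v) \<Rightarrow> 'v \<Rightarrow>
      int \<Rightarrow> 'v \<Rightarrow> int \<Rightarrow> ('v \<Rightarrow> complex) \<Rightarrow> ('v \<Rightarrow> complex)"
  where "contragredient_mode smul Y \<omega> k u n f = (\<lambda>w. f (opp_mode smul Y \<omega> k u n w))"

definition iso_to_contragredient ::
    "(complex \<Rightarrow> 'v \<Rightarrow> 'v::ab_group_add) \<Rightarrow> ('v \<Rightarrow> int \<Rightarrow> 'v \<Rightarrow> 'v) \<Rightarrow> 'v \<Rightarrow> bool"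
  where "iso_to_contragredient smul Y \<omega> \<longleftrightarrow>
      (\<exists>\<phi>. bij_betw \<phi> UNIV (restricted_dual smul Y \<omega>) \<and>
        (\<forall>u v. \<phi> (u + v) = (\<lambda>w. \<phi> u w + \<phi> v w)) \<and>
        (\<forall>a v. \<phi> (smul a v) = (\<lambda>w. a * \<phi> v w)) \<and>
        (\<forall>k. \<forall>u \<in> wt_space smul Y \<omega> k. \<forall>n v.
          \<phi> (Y u n v) = contragredient_mode smul Y \<omega> k u n (\<phi> v)))"

definition normalized_invariant_form ::
    "(complex \<Rightarrow> 'v \<Rightarrow> 'v::ab_group_add) \<Rightarrow> ('v \<Rightarrow> int \<Rightarrow> 'v \<Rightarrow> 'v) \<Rightarrow> 'v \<Rightarrow> 'v \<Rightarrow>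
      ('v \<Rightarrow> 'v \<Rightarrow> complex) \<Rightarrow> bool"
  where "normalized_invariant_form smul Y vac \<omega> B \<longleftrightarrow>
      (\<forall>u. Vector_Spaces.linear smul (*) (B u)) \<and>
      (\<forall>v. Vector_Spaces.linear smul (*) (\<lambda>u. B u v)) \<and>
      (\<forall>u. (\<forall>v. B u v = 0) \<longrightarrow> u = 0) \<and>
      (\<forall>v. (\<forall>u. B u v = 0) \<longrightarrow> v = 0) \<and>
      (\<forall>k. \<forall>u \<in> wt_space smul Y \<omega> k. \<forall>n v w.
        B (Y u n v) w = B v (opp_mode smul Y \<omega> k u n w)) \<and>
      B vac vac = 1"

text \<open>
  Points and tuples of vectors are functions on \<open>nat\<close> of which only the values at
  \<open>1, \<dots>, n\<close> matter.
\<close>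

definition polynomial_fun :: "nat \<Rightarrow> ((nat \<Rightarrow> complex) \<Rightarrow> complex) \<Rightarrow> bool"
  where "polynomial_fun n P \<longleftrightarrow>
      (\<exists>(A :: (nat \<Rightarrow> nat) set) c. finite A \<and>
        P = (\<lambda>y. \<Sum>\<alpha>\<in>A. c \<alpha> * (\<Prod>k=1..n. y k ^ \<alpha> k)))"

definition radially_ordered :: "nat \<Rightarrow> (nat \<Rightarrow> complex) set"
  where "radially_ordered n = {y. \<forall>i\<in>{1..n}. \<forall>j\<in>{1..n}. i < j \<longrightarrow> norm (y i) > norm (y j)}"

definition npoint_term ::
    "('v \<Rightarrow> int \<Rightarrow> 'v \<Rightarrow> 'v) \<Rightarrow> 'v \<Rightarrow> ('v \<Rightarrow> 'v \<Rightarrow> complex) \<Rightarrow> nat \<Rightarrow>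
      (nat \<Rightarrow> 'v) \<Rightarrow> (nat \<Rightarrow> complex) \<Rightarrow> (nat \<Rightarrow> int) \<Rightarrow> complex"
  where "npoint_term Y vac B n v y m =
      B vac (foldr (\<lambda>k w. Y (v k) (m k) w) [1..<Suc n] vac) * (\<Prod>k=1..n. y k powi (- m k - 1))"

text \<open>
  \<open>Z0 Y vac B n v y\<close> is the value at \<open>y\<close> of the rational function \<open>P/Q\<close> to which
  \<open>\<langle>1, Y(v\<^sub>1,y\<^sub>1) \<dots> Y(v\<^sub>n,y\<^sub>n) 1\<rangle>\<close> sums in the domain of radial ordering. It is
  meaningful at each \<open>y\<close> at which this rational function is regular. The value does not depend
  on the representation, since a rational function is determined by its values on a nonempty open
  set.
\<close>

definition Z0 ::
    "('v \<Rightarrow> int \<Rightarrow> 'v \<Rightarrow> 'v) \<Rightarrow> 'v \<Rightarrow> ('v \<Rightarrow> 'v \<Rightarrow> complex) \<Rightarrow> nat \<Rightarrow>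
      (nat \<Rightarrow> 'v) \<Rightarrow> (nat \<Rightarrow> complex) \<Rightarrow> complex"
  where "Z0 Y vac B n v y =
      (THE z. \<exists>P Q. polynomial_fun n P \<and> polynomial_fun n Q \<and> Q y \<noteq> 0 \<and> z = P y / Q y \<and>
        (\<forall>x \<in> radially_ordered n. Q x \<noteq> 0 \<longrightarrow>
          (npoint_term Y vac B n v x has_sum P x / Q x) ({1..n} \<rightarrow>\<^sub>E UNIV)))"

end

theory Submission
  imports Defs
begin

text \<open>
  The idea is to replace the analytic \<open>n\<close>-point function by an algebraic object, on which
  covariance can be read off.

  Since \<open>V\<close> has no negative weights and \<open>V\<^sub>0\<close> is spanned by the vacuum, the functional
  \<open>\<langle>1, \<cdot>\<rangle>\<close> is annihilated by all \<open>u\<^sub>m\<close> with \<open>m < 0\<close>, except that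
  \<open>\<langle>1, u\<^bsub>-1\<^esub> w\<rangle> = \<langle>1, u\<rangle> \<langle>1, w\<rangle>\<close> (lemma \<open>form_vac_negative_mode\<close>). The modes with
  \<open>m \<ge> 0\<close> kill the vacuum and can be moved to the right by the commutator formula. As
  \<open>\<Sum>\<^sub>m (m choose i) z\<^bsup>-m-1\<^esup> w\<^bsup>m-i\<^esup> = (z - w)\<^bsup>-i-1\<^esup>\<close> for \<open>|w| < |z|\<close>, summing over \<open>m\<close> expresses an
  \<open>n\<close>-point function through \<open>(n-1)\<close>-point functions:
  \<open>F(u,z; v\<^sub>1,z\<^sub>1; \<dots>) = \<langle>1,u\<rangle> F(v\<^sub>1,z\<^sub>1; \<dots>) + \<Sum>\<^sub>j \<Sum>\<^sub>i (z - z\<^sub>j)\<^bsup>-i-1\<^esup> F(\<dots>; u\<^sub>i v\<^sub>j,z\<^sub>j; \<dots>)\<close>.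
  This finite recursion is the definition of \<open>correlator\<close>. By \<open>correlator_has_sum\<close> the mode
  expansion converges to it, and it is visibly rational with poles only where two points coincide,
  so \<open>Z0\<close> is the correlator at every tuple of distinct points (\<open>Z0_eq_correlator\<close>).

  A Moebius map with \<open>c \<noteq> 0\<close> is a translation, followed by a scaling, the inversion
  \<open>y \<mapsto> 1/y\<close> and another translation; for \<open>c = 0\<close> it is affine. The recursion depends on differences of points only,
  which gives translations, and it respects weights, which gives scalings. For the
  inversion, invariance of the form moves all fields to the other side: the series of
  \<open>\<langle>Y(v\<^sub>1,y\<^sub>1) \<cdots> Y(v\<^sub>n,y\<^sub>n) 1, 1\<rangle>\<close> becomes term by term that of the transformed vectors at the points
  \<open>1/y\<^sub>n, \<dots>, 1/y\<^sub>1\<close>, which are again radially ordered. The resulting identity on an open set extends to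
  all distinct nonzero points because both sides are rational.

  What remains is to undo the reversal of the order, that is, the symmetry of
  correlators (\<open>correlator_rev\<close>). For two adjacent fields \<open>u\<close>, \<open>w\<close> one applies the recursion twice; after the
  commutator formula and skew-symmetry both orders are combinations of
  \<open>(u\<^sub>s w)\<^sub>p v\<^sub>j\<close>, and the coefficients agree by the partial fraction expansion of
  \<open>(x - y)\<^bsup>-s-1\<^esup> y\<^bsup>-p-1\<^esup>\<close> (\<open>partial_fractions\<close>, \<open>site_identity\<close>).
\<close>

section \<open>Modes, weights and the invariant form\<close>

locale cft_voa = vertex_operator_algebra smul Y vac \<omega>
  for smul :: "complex \<Rightarrow> 'v::ab_group_add \<Rightarrow> 'v"
    and Y :: "'v \<Rightarrow> int \<Rightarrow> 'v \<Rightarrow> 'v" and vac \<omega> :: 'v +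
  fixes B :: "'v \<Rightarrow> 'v \<Rightarrow> complex"
  assumes cft: "strong_cft_type smul Y vac \<omega>"
    and form: "normalized_invariant_form smul Y vac \<omega> B"
begin

abbreviation L :: "int \<Rightarrow> 'v \<Rightarrow> 'v" where "L \<equiv> vir Y \<omega>"
abbreviation V :: "int \<Rightarrow> 'v set" where "V \<equiv> wt_space smul Y \<omega>"

lemma mode_linear_left:
  "Y (u + u') n w = Y u n w + Y u' n w" "Y (smul r u) n w = smul r (Y u n w)"
  using linear_field[of n w] by (simp_all add: Vector_Spaces.linear_iff)

lemma mode_linear_right:
  "Y u n (w + w') = Y u n w + Y u n w'" "Y u n (smul r w) = smul r (Y u n w)"
  using linear_mode[of u n] by (simp_all add: Vector_Spaces.linear_iff)

lemma mode_zero [simp]: "Y 0 n w = 0" "Y u n 0 = 0"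
  using mode_linear_left(2)[of 0 u n w] mode_linear_right(2)[of u n 0 w] by simp_all

lemma mode_sum_left: "Y (sum f S) n w = (\<Sum>i\<in>S. Y (f i) n w)"
  by (induction S rule: infinite_finite_induct) (simp_all add: mode_linear_left)

lemma mode_sum_right: "Y u n (sum f S) = (\<Sum>i\<in>S. Y u n (f i))"
  by (induction S rule: infinite_finite_induct) (simp_all add: mode_linear_right)

lemma form_linear_right: "B u (w + w') = B u w + B u w'" "B u (smul r w) = r * B u w"
  using form by (simp_all add: normalized_invariant_form_def Vector_Spaces.linear_iff)

lemma form_linear_left: "B (u + u') w = B u w + B u' w" "B (smul r u) w = r * B u w"
  using form by (simp_all add: normalized_invariant_form_def Vector_Spaces.linear_iff)

lemma form_zero [simp]: "B 0 w = 0" "B u 0 = 0"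
  using form_linear_left(2)[of 0 u w] form_linear_right(2)[of u 0 w] by simp_all

lemma form_sum_right: "B u (sum f S) = (\<Sum>i\<in>S. B u (f i))"
  by (induction S rule: infinite_finite_induct) (simp_all add: form_linear_right)

lemma form_vac [simp]: "B vac vac = 1"
  using form by (simp add: normalized_invariant_form_def)

lemma form_invariant: "u \<in> V k \<Longrightarrow> B (Y u n w) w' = B w (opp_mode smul Y \<omega> k u n w')"
  using form by (simp add: normalized_invariant_form_def)

lemma Sum_any_eq_single:
  assumes "\<And>i. i \<noteq> a \<Longrightarrow> f i = (0::'b::comm_monoid_add)"
  shows "Sum_any f = f a"
proof -
  have "Sum_any f = sum f {a}"
    by (rule Sum_any.expand_superset) (use assms in auto)
  then show ?thesis by simp
qed

lemma Sum_any_eq_lessThan: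
  assumes "\<And>i. i \<ge> (N::nat) \<Longrightarrow> f i = (0::'b::comm_monoid_add)"
  shows "Sum_any f = sum f {..<N}"
  by (rule Sum_any.expand_superset) (use assms in \<open>auto simp: not_less[symmetric]\<close>)

text \<open>
  The case \<open>l = 0\<close> of the Jacobi identity, in which both sums on the left collapse.
\<close>
lemma mode_commutator:
  "Y u m (Y v n w) = Y v n (Y u m w)
     + Sum_any (\<lambda>i::nat. smul (of_int m gchoose i) (Y (Y u (int i) v) (m + n - int i) w))"
proof -
  have g0: "(0 gchoose i) = (0::complex)" if "i \<noteq> 0" for i
    using that by (metis gbinomial_of_nat_symmetric binomial_eq_0 binomial_gbinomial neq0_conv of_nat_0)
  have "Sum_any (\<lambda>i::nat. smul ((-1) ^ i * (of_int 0 gchoose i)) (Y u (0 + m - int i) (Y v (n + int i) w)))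
      = Y u m (Y v n w)"
    by (subst Sum_any_eq_single[where a = 0]) (auto simp: g0)
  moreover have "Sum_any (\<lambda>i::nat. smul ((-1) ^ i * (-1) powi 0 * (of_int 0 gchoose i)) (Y v (0 + n - int i) (Y u (m + int i) w)))
      = Y v n (Y u m w)"
    by (subst Sum_any_eq_single[where a = 0]) (auto simp: g0)
  ultimately show ?thesis
    using jacobi[of 0 u m v n w] by (simp add: algebra_simps)
qed

lemma mode_commutator_nat:
  "Y u (int M) (Y v n w) = Y v n (Y u (int M) w)
     + (\<Sum>i\<le>M. smul (of_nat (M choose i)) (Y (Y u (int i) v) (int M + n - int i) w))"
proof -
  have "Sum_any (\<lambda>i::nat. smul (of_int (int M) gchoose i) (Y (Y u (int i) v) (int M + n - int i) w))
     = (\<Sum>i\<le>M. smul (of_nat (M choose i)) (Y (Y u (int i) v) (int M + n - int i) w))"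
    by (subst Sum_any_eq_lessThan[where N = "Suc M"])
       (auto simp: binomial_gbinomial[symmetric] lessThan_Suc_atMost)
  then show ?thesis using mode_commutator[of u "int M" v n w] by simp
qed

text \<open>
  Exchanging the roles of \<open>u\<close> and \<open>v\<close>, together with \<open>m\<close> and \<open>n\<close>, in the Jacobi identity
  reproduces its left-hand side up to the sign \<open>-(-1)\<^sup>l\<close>, so the two right-hand sides agree up to that sign; the
  exponent that belongs to \<open>v\<close> is set to \<open>0\<close>, which leaves a single term on one side. This
  form of skew-symmetry avoids exponentials of \<open>L(-1)\<close>.
\<close>
lemma skew_symmetry:
  "Y (Y v l u) m w = smul (- ((-1) powi l))
     (Sum_any (\<lambda>i::nat. smul (of_int m gchoose i) (Y (Y u (l + int i) v) (m - int i) w)))"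
proof -
  let ?A = "Sum_any (\<lambda>i::nat. smul ((-1) ^ i * (of_int l gchoose i))
          (Y u (l + m - int i) (Y v (0 + int i) w)))"
  let ?A' = "Sum_any (\<lambda>i::nat. smul ((-1) ^ i * (-1) powi l * (of_int l gchoose i))
          (Y u (l + m - int i) (Y v (0 + int i) w)))"
  let ?C = "Sum_any (\<lambda>i::nat. smul ((-1) ^ i * (of_int l gchoose i))
          (Y v (l + 0 - int i) (Y u (m + int i) w)))"
  let ?C' = "Sum_any (\<lambda>i::nat. smul ((-1) ^ i * (-1) powi l * (of_int l gchoose i))
          (Y v (l + 0 - int i) (Y u (m + int i) w)))"
  have sgn: "(-1) powi l * (-1) powi l = (1::complex)"
    by (simp flip: power_int_mult_distrib)
  have g0: "(0 gchoose i) = (0::complex)" if "i \<noteq> 0" for i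
    using that by (metis gbinomial_of_nat_symmetric binomial_eq_0 binomial_gbinomial neq0_conv of_nat_0)
  have pull: "Sum_any (\<lambda>i::nat. smul ((-1) ^ i * (-1) powi l * c i) (f i))
      = smul ((-1) powi l) (Sum_any (\<lambda>i. smul ((-1)^i * c i) (f i)))"
    if "\<exists>N. \<forall>i\<ge>N. f i = 0" for c f
  proof -
    from that obtain N where N: "\<And>i. i \<ge> N \<Longrightarrow> f i = 0" by blast
    show ?thesis
      by (subst (1 2) Sum_any_eq_lessThan[where N = N])
         (auto simp: N scale_sum_right mult.assoc mult.left_commute)
  qed
  have "\<exists>N. \<forall>i\<ge>N. Y u (l + m - int i) (Y v (0 + int i) w) = 0"
  proof -
    obtain N where "\<forall>n\<ge>N. Y v n w = 0" using truncation by blast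
    then have "\<forall>i\<ge>nat N. Y u (l + m - int i) (Y v (0 + int i) w) = 0" by auto
    then show ?thesis by blast
  qed
  then have A: "?A' = smul ((-1) powi l) ?A" by (rule pull)
  have "\<exists>N. \<forall>i\<ge>N. Y v (l + 0 - int i) (Y u (m + int i) w) = 0"
  proof -
    obtain N where "\<forall>n\<ge>N. Y u n w = 0" using truncation by blast
    then have "\<forall>i\<ge>nat (N - m). Y v (l + 0 - int i) (Y u (m + int i) w) = 0" by auto
    then show ?thesis by blast
  qed
  then have C: "?C' = smul ((-1) powi l) ?C" by (rule pull)
  have "Sum_any (\<lambda>i::nat. smul (of_int 0 gchoose i) (Y (Y v (l + int i) u) (0 + m - int i) w))
      = Y (Y v l u) m w"
    by (subst Sum_any_eq_single[where a = 0]) (auto simp: g0)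
  then have "?C - ?A' = Y (Y v l u) m w" using jacobi[of l v 0 u m w] by simp
  moreover have "?A - ?C' = Sum_any (\<lambda>i::nat. smul (of_int m gchoose i) (Y (Y u (l + int i) v) (m - int i) w))"
    using jacobi[of l u m v 0 w] by simp
  moreover have "?C - ?A' = smul (- ((-1) powi l)) (?A - ?C')"
    unfolding A C by (simp add: scale_right_diff_distrib sgn)
  ultimately show ?thesis by simp
qed

lemma L_vac: "n \<ge> -1 \<Longrightarrow> L n vac = 0"
  by (simp add: vir_def creation)

lemma L_minus2_vac: "L (-2) vac = \<omega>"
  by (simp add: vir_def creation')

lemma smul_wt: "u \<in> V k \<Longrightarrow> smul r u \<in> V k"
  by (simp add: wt_space_def vir_def mode_linear_right mult.commute)

text \<open>
  The commutator of \<open>L(0) = \<omega>\<^sub>1\<close> with \<open>u\<^sub>m\<close> has the two terms \<open>(L(-1)u)\<^bsub>m+1\<^esub>\<close> and \<open>(L(0)u)\<^sub>m\<close>; the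
  first equals \<open>-(m+1) u\<^sub>m\<close> by the derivative property.
\<close>
lemma wt_mode:
  assumes "u \<in> V k" "w \<in> V q"
  shows "Y u m w \<in> V (k + q - m - 1)"
proof -
  have der: "Y (Y \<omega> 0 u) (m + 1) w = smul (- of_int (m + 1)) (Y u m w)"
    using derivative[of u "m + 1" w] by (simp add: vir_def)
  have "L 0 (Y u m w) = Y u m (L 0 w) + (Y (Y \<omega> 0 u) (1 + m) w + Y (Y \<omega> 1 u) m w)"
    using mode_commutator_nat[of \<omega> 1 u m w] by (simp add: vir_def algebra_simps)
  also have "Y u m (L 0 w) = smul (of_int q) (Y u m w)"
    using assms by (simp add: wt_space_def mode_linear_right)
  also have "Y (Y \<omega> 1 u) m w = smul (of_int k) (Y u m w)"
    using assms by (simp add: wt_space_def vir_def mode_linear_left)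
  also have "Y (Y \<omega> 0 u) (1 + m) w = smul (- of_int (m + 1)) (Y u m w)"
    using der by (simp add: add.commute)
  finally show ?thesis
    by (simp add: wt_space_def scale_left_distrib scale_left_diff_distrib)
qed

lemma wt_eq_zero: "k < 0 \<Longrightarrow> u \<in> V k \<Longrightarrow> u = 0"
  using cft by (auto simp: strong_cft_type_def)

lemma wt0_vac: "u \<in> V 0 \<Longrightarrow> \<exists>r. u = smul r vac"
  using cft by (auto simp: strong_cft_type_def)

lemma omega_wt: "\<omega> \<in> V 2"
proof -
  obtain cc where "\<forall>m n v. L m (L n v) - L n (L m v)
      = smul (of_int (m - n)) (L (m + n) v)
        + (if m + n = 0 then smul (of_int (m ^ 3 - m) / 12 * cc) v else 0)"
    using virasoro by blast
  from this[rule_format, of 0 "-2" vac] show ?thesis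
    by (simp add: wt_space_def L_minus2_vac L_vac) (simp add: vir_def)
qed

lemma L1_omega: "L 1 \<omega> = 0"
proof -
  obtain cc where "\<forall>m n v. L m (L n v) - L n (L m v)
      = smul (of_int (m - n)) (L (m + n) v)
        + (if m + n = 0 then smul (of_int (m ^ 3 - m) / 12 * cc) v else 0)"
    using virasoro by blast
  from this[rule_format, of 1 "-2" vac] show ?thesis
    by (simp add: L_minus2_vac L_vac) (simp add: vir_def)
qed

lemma L1_wt: "u \<in> V k \<Longrightarrow> L 1 u \<in> V (k - 1)"
  using wt_mode[OF omega_wt, of u k 2] by (simp add: vir_def)

lemma L1_pow_wt: "u \<in> V k \<Longrightarrow> (L 1 ^^ j) u \<in> V (k - int j)"
proof (induction j)
  case (Suc j)
  then show ?case using L1_wt[of "(L 1 ^^ j) u" "k - int j"] by (simp add: algebra_simps)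
qed simp

lemma L1_pow_smul: "(L 1 ^^ j) (smul r u) = smul r ((L 1 ^^ j) u)"
  by (induction j) (simp_all add: vir_def mode_linear_right)

lemma L1_pow_eq_zero: "u \<in> V k \<Longrightarrow> int j > k \<Longrightarrow> (L 1 ^^ j) u = 0"
  using wt_eq_zero[OF _ L1_pow_wt[of u k j]] by simp

text \<open>
  Invariance applied to \<open>\<omega>\<^sub>1\<close>. The correction terms of the opposite mode vanish because
  \<open>L(1) L(-2) 1 = 3 L(-1) 1 = 0\<close>.
\<close>
lemma form_L0: "B (L 0 u) w = B u (L 0 w)"
proof -
  have pow: "(L 1 ^^ j) \<omega> = 0" if "j \<noteq> 0" for j
    using that
  proof (induction j)
    case (Suc j)
    then show ?case by (cases "j = 0") (simp_all add: L1_omega[unfolded vir_def, simplified] vir_def)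
  qed simp
  have "opp_mode smul Y \<omega> 2 \<omega> 1 w = Y \<omega> 1 w"
    unfolding opp_mode_def by (subst Sum_any_eq_single[where a = 0]) (simp_all add: pow)
  then show ?thesis using form_invariant[OF omega_wt, of 1 u w] by (simp add: vir_def)
qed

lemma form_vac_wt:
  assumes "w \<in> V q" "q \<noteq> 0"
  shows "B vac w = 0" "B w vac = 0"
  using form_L0[of vac w] form_L0[of w vac] assms
  by (simp_all add: L_vac wt_space_def form_linear_right form_linear_left)

text \<open>
  Linear statements need only be checked on homogeneous vectors.
\<close>
lemma homogeneous_induct [consumes 0, case_names wt zero add]:
  assumes "\<And>k x. x \<in> V k \<Longrightarrow> P x" "P 0" "\<And>x y. P x \<Longrightarrow> P y \<Longrightarrow> P (x + y)"
  shows "P u"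
proof -
  have "u \<in> span (\<Union>k. V k)" using grading by simp
  then show ?thesis
  proof (induction rule: span_induct_alt)
    case base
    show ?case by (rule assms(2))
  next
    case (step c x y)
    then show ?case using assms(1,3) smul_wt by blast
  qed
qed

lemma form_vac_commute: "B vac w = B w vac"
proof (induction w rule: homogeneous_induct)
  case (wt k x)
  show ?case
  proof (cases "k = 0")
    case True
    then obtain r where "x = smul r vac" using wt wt0_vac by blast
    then show ?thesis by (simp add: form_linear_left form_linear_right)
  next
    case False
    then show ?thesis using form_vac_wt[OF wt] by simp
  qed
qed (simp_all add: form_linear_left form_linear_right)

text \<open>
  For homogeneous \<open>u\<close>, \<open>w\<close> of weights \<open>k, q \<ge> 0\<close> the vector \<open>u\<^sub>m w\<close> has weight
  \<open>k + q - m - 1\<close>. For \<open>m < 0\<close> this can only be zero if \<open>k = q = 0\<close> and \<open>m = -1\<close>, and then both vectors are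
  multiples of the vacuum.
\<close>
lemma form_vac_negative_mode:
  assumes "m < 0"
  shows "B vac (Y u m w) = (if m = -1 then B vac u * B vac w else 0)"
proof (induction u rule: homogeneous_induct)
  case (wt k u)
  note u = wt
  show ?case
  proof (induction w rule: homogeneous_induct)
    case (wt q w)
    note Yw = wt_mode[OF u wt, of m]
    \<comment> \<open>The first two cases are empty since there are no negative weights.\<close>
    consider "k < 0" | "q < 0" | "k > 0" "q \<ge> 0" | "k = 0" "q > 0" | "k = 0" "q = 0" by linarith
    then show ?case
    proof cases
      case 3
      then show ?thesis using form_vac_wt(1)[OF Yw] form_vac_wt(1)[OF u] assms by auto
    next
      case 4
      then show ?thesis using form_vac_wt(1)[OF Yw] form_vac_wt(1)[OF wt] assms by auto
    next
      case 5
      then obtain r s where "u = smul r vac" "w = smul s vac" using u wt wt0_vac by blast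
      then show ?thesis
        by (simp add: mode_linear_left vacuum form_linear_right mode_linear_right)
    qed (use wt_eq_zero[OF _ u] wt_eq_zero[OF _ wt] in auto)
  qed (simp_all add: mode_linear_right form_linear_right ring_distribs)
qed (simp_all add: mode_linear_left form_linear_right ring_distribs)

end

section \<open>Correlators defined by recursion on the leftmost field\<close>

context cft_voa
begin

text \<open>
  The family of vectors and the family of points are indexed by \<open>nat\<close>, and the list only
  records which indices occur and in which order. Replacing \<open>v\<^sub>j\<close> by \<open>u\<^sub>i v\<^sub>j\<close> is then a function update, and
  permuting the fields permutes the list while the sum over its elements stays the same.
\<close>
primrec correlator :: "nat list \<Rightarrow> (nat \<Rightarrow> 'v) \<Rightarrow> (nat \<Rightarrow> complex) \<Rightarrow> complex" where
  "correlator [] v x = 1"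
| "correlator (k # ks) v x = B vac (v k) * correlator ks v x
     + (\<Sum>j\<in>set ks. Sum_any (\<lambda>i::nat. inverse (x k - x j) ^ Suc i
          * correlator ks (v(j := Y (v k) (int i) (v j))) x))"

lemma correlator_cong:
  assumes "\<And>k. k \<in> set ks \<Longrightarrow> v k = v' k" "\<And>k. k \<in> set ks \<Longrightarrow> x k = x' k"
  shows "correlator ks v x = correlator ks v' x'"
  using assms
proof (induction ks arbitrary: v v')
  case (Cons k ks)
  have 1: "correlator ks v x = correlator ks v' x'"
    by (rule Cons.IH) (use Cons.prems in auto)
  have 2: "correlator ks (v(j := Y (v' k) (int i) (v' j))) x
         = correlator ks (v'(j := Y (v' k) (int i) (v' j))) x'" if "j \<in> set ks" for i j
    by (rule Cons.IH) (use Cons.prems that in auto)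
  have "x k = x' k" "v k = v' k" using Cons.prems by auto
  then show ?case
    unfolding correlator.simps 1
    by (intro arg_cong2[where f = "(+)"] sum.cong refl)
       (simp_all only: 2 Cons.prems list.set_intros)
qed simp

lemma correlator_upd_notin: "p \<notin> set ks \<Longrightarrow> correlator ks (v(p := w)) x = correlator ks v x"
  by (rule correlator_cong) auto

text \<open>
  Vanishing is proved before linearity: it makes the sums over the mode index \<open>i\<close> in the
  recursion finite, hence manageable.
\<close>
lemma correlator_zero:
  assumes "p \<in> set ks" "v p = 0"
  shows "correlator ks v x = 0"
  using assms
proof (induction ks arbitrary: v p)
  case (Cons k ks)
  have tail: "correlator ks (v(j := Y (v k) (int i) (v j))) x = 0" if "j \<in> set ks" for i j
  proof (cases "p \<in> set ks")
    case True
    then show ?thesis using Cons.prems(2) by (intro Cons.IH[of p]) auto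
  next
    case False
    then have "v k = 0" using Cons.prems by auto
    then show ?thesis using that by (intro Cons.IH[of j]) auto
  qed
  have "B vac (v k) * correlator ks v x = 0"
    using Cons by (cases "p = k") auto
  then show ?case by (simp add: tail)
qed simp

text \<open>
  A common truncation bound lets all \<open>Sum_any\<close> terms of one recursion step be
  rewritten as finite sums over the same range.
\<close>
lemma truncation_uniform:
  assumes "finite S" "finite T"
  shows "\<exists>N::nat. \<forall>u\<in>S. \<forall>w\<in>T. \<forall>i\<ge>N. Y u (int i) w = 0"
proof -
  have "\<forall>p. \<exists>N::nat. \<forall>i\<ge>N. Y (fst p) (int i) (snd p) = 0"
  proof
    fix p :: "'v \<times> 'v"
    obtain N where "\<forall>n\<ge>N. Y (fst p) n (snd p) = 0" using truncation by blast
    then have "\<forall>i\<ge>nat N. Y (fst p) (int i) (snd p) = 0" by auto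
    then show "\<exists>N::nat. \<forall>i\<ge>N. Y (fst p) (int i) (snd p) = 0" by blast
  qed
  then obtain N :: "'v \<times> 'v \<Rightarrow> nat" where N: "\<And>p i. i \<ge> N p \<Longrightarrow> Y (fst p) (int i) (snd p) = 0"
    by metis
  have fin: "finite (N ` (S \<times> T))" using assms by simp
  have "Y u (int i) w = 0" if "u \<in> S" "w \<in> T" "i \<ge> Max (N ` (S \<times> T))" for u w i
  proof -
    have "N (u, w) \<le> Max (N ` (S \<times> T))" using that by (intro Max_ge[OF fin]) auto
    then show ?thesis using N[of "(u, w)" i] that by simp
  qed
  then show ?thesis by blast
qed

lemma correlator_Cons:
  assumes "\<And>j i. j \<in> set ks \<Longrightarrow> i \<ge> N \<Longrightarrow> Y (v k) (int i) (v j) = 0"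
  shows "correlator (k # ks) v x = B vac (v k) * correlator ks v x
     + (\<Sum>j\<in>set ks. \<Sum>i<N. inverse (x k - x j) ^ Suc i
          * correlator ks (v(j := Y (v k) (int i) (v j))) x)"
proof -
  have "Sum_any (\<lambda>i::nat. inverse (x k - x j) ^ Suc i
          * correlator ks (v(j := Y (v k) (int i) (v j))) x)
      = (\<Sum>i<N. inverse (x k - x j) ^ Suc i
          * correlator ks (v(j := Y (v k) (int i) (v j))) x)" if "j \<in> set ks" for j
    using that assms correlator_zero[of j ks]
    by (intro Sum_any_eq_lessThan) auto
  then show ?thesis by simp
qed

lemma correlator_linear:
  assumes "p \<in> set ks" "distinct ks"
  shows "correlator ks (v(p := w + smul r w')) x
    = correlator ks (v(p := w)) x + r * correlator ks (v(p := w')) x"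
  using assms
proof (induction ks arbitrary: p v w r w')
  case (Cons k ks)
  obtain N where N: "\<forall>u\<in>{w, w', w + smul r w'} \<union> v ` set (k # ks).
      \<forall>w''\<in>{w, w', w + smul r w'} \<union> v ` set ks. \<forall>i\<ge>N. Y u (int i) w'' = 0"
    using truncation_uniform[of "{w, w', w + smul r w'} \<union> v ` set (k # ks)"
        "{w, w', w + smul r w'} \<union> v ` set ks"] by auto
  have exp: "correlator (k # ks) (v(p := a)) x = B vac ((v(p := a)) k) * correlator ks (v(p := a)) x
     + (\<Sum>j\<in>set ks. \<Sum>i<N. inverse (x k - x j) ^ Suc i
          * correlator ks (v(p := a, j := Y ((v(p := a)) k) (int i) ((v(p := a)) j))) x)"
    if "a \<in> {w, w', w + smul r w'}" for a
    by (rule correlator_Cons) (use N that in auto)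
  note [simp del] = correlator.simps
  show "correlator (k # ks) (v(p := w + smul r w')) x
    = correlator (k # ks) (v(p := w)) x + r * correlator (k # ks) (v(p := w')) x"
  proof (cases "p = k")
    case True
    then have k: "p \<notin> set ks" using Cons.prems by auto
    have "correlator ks (v(p := a, j := Y ((v(p := a)) k) (int i) ((v(p := a)) j))) x
       = correlator ks (v(j := Y a (int i) (v j))) x" if "j \<in> set ks" for a i j
      by (rule correlator_cong) (use k that True in auto)
    then have exp': "correlator (k # ks) (v(p := a)) x = B vac a * correlator ks v x
        + (\<Sum>j\<in>set ks. \<Sum>i<N. inverse (x k - x j) ^ Suc i
            * correlator ks (v(j := Y a (int i) (v j))) x)"
      if "a \<in> {w, w', w + smul r w'}" for a
      unfolding exp[OF that] using True k by (simp add: correlator_upd_notin)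
    have "correlator ks (v(j := Y (w + smul r w') (int i) (v j))) x
       = correlator ks (v(j := Y w (int i) (v j))) x + r * correlator ks (v(j := Y w' (int i) (v j))) x"
      if "j \<in> set ks" for i j
      unfolding mode_linear_left by (rule Cons.IH) (use that Cons.prems in auto)
    then show ?thesis
      by (simp add: exp' form_linear_right sum.distrib sum_distrib_left algebra_simps)
  next
    case False
    then have p: "p \<in> set ks" and d: "distinct ks" using Cons.prems by auto
    have j: "correlator ks (v(p := w + smul r w', j := Y (v k) (int i) ((v(p := w + smul r w')) j))) x
       = correlator ks (v(p := w, j := Y (v k) (int i) ((v(p := w)) j))) x
         + r * correlator ks (v(p := w', j := Y (v k) (int i) ((v(p := w')) j))) x"
      if "j \<in> set ks" for i j
    proof (cases "j = p")
      case True
      have "correlator ks (v(p := Y (v k) (int i) w + smul r (Y (v k) (int i) w'))) x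
         = correlator ks (v(p := Y (v k) (int i) w)) x + r * correlator ks (v(p := Y (v k) (int i) w')) x"
        by (rule Cons.IH[OF p d])
      then show ?thesis using True by (simp add: mode_linear_right)
    next
      case False
      have "correlator ks (v(j := Y (v k) (int i) (v j), p := w + smul r w')) x
         = correlator ks (v(j := Y (v k) (int i) (v j), p := w)) x
           + r * correlator ks (v(j := Y (v k) (int i) (v j), p := w')) x"
        by (rule Cons.IH[OF p d])
      then show ?thesis using False by (simp add: fun_upd_twist)
    qed
    define X where "X a j i = correlator ks (v(p := a, j := Y (v k) (int i) ((v(p := a)) j))) x" for a j i
    define H where "H a = correlator ks (v(p := a)) x" for a
    have exp': "correlator (k # ks) (v(p := a)) x = B vac (v k) * H a
        + (\<Sum>j\<in>set ks. \<Sum>i<N. inverse (x k - x j) ^ Suc i * X a j i)"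
      if "a \<in> {w, w', w + smul r w'}" for a
      unfolding exp[OF that] using False by (simp add: X_def H_def)
    have "H (w + smul r w') = H w + r * H w'"
      unfolding H_def by (rule Cons.IH[OF p d])
    moreover have "X (w + smul r w') j i = X w j i + r * X w' j i" if "j \<in> set ks" for i j
      unfolding X_def by (rule j[OF that])
    ultimately show ?thesis
      by (simp add: exp' sum.distrib sum_distrib_left algebra_simps)
  qed
qed simp

lemma correlator_smul:
  assumes "p \<in> set ks" "distinct ks"
  shows "correlator ks (v(p := smul r w)) x = r * correlator ks (v(p := w)) x"
  using correlator_linear[OF assms, of v 0 r w x] correlator_zero[OF assms(1), of "v(p := 0)"]
  by simp

lemma correlator_sum:
  assumes "p \<in> set ks" "distinct ks"
  shows "correlator ks (v(p := \<Sum>i\<in>S. smul (r i) (w i))) x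
    = (\<Sum>i\<in>S. r i * correlator ks (v(p := w i)) x)"
proof (induction S rule: infinite_finite_induct)
  case (insert i S)
  show ?case
    unfolding sum.insert[OF insert(1,2)]
    by (subst add.commute, subst correlator_linear[OF assms]) (simp only: insert(3) add.commute)
qed (use correlator_zero[OF assms(1)] in auto)

lemma correlator_translate: "correlator ks v (\<lambda>k. x k + s) = correlator ks v x"
  by (induction ks arbitrary: v) simp_all

text \<open>
  A pole of order \<open>i + 1\<close> scales like \<open>r\<^bsup>-i-1\<^esup>\<close>, and the vector \<open>u\<^sub>i v\<^sub>j\<close> that accompanies it
  has weight \<open>i + 1\<close> less than \<open>u\<close> and \<open>v\<^sub>j\<close> together.
\<close>
lemma correlator_scale:
  assumes "\<And>k. k \<in> set ks \<Longrightarrow> v k \<in> V (q k)" "distinct ks" "r \<noteq> 0"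
  shows "correlator ks v (\<lambda>k. r * x k) = r powi (- (\<Sum>k\<in>set ks. q k)) * correlator ks v x"
  using assms(1,2)
proof (induction ks arbitrary: v q)
  case (Cons k ks)
  let ?s = "\<Sum>k\<in>set ks. q k"
  have k: "k \<notin> set ks" and d: "distinct ks" using Cons.prems by auto
  have 1: "correlator ks v (\<lambda>k. r * x k) = r powi (- ?s) * correlator ks v x"
    by (rule Cons.IH) (use Cons.prems in auto)
  have 2: "B vac (v k) * (r powi (- (\<Sum>k\<in>set (k # ks). q k))) = B vac (v k) * (r powi (- ?s))"
    using form_vac_wt(1)[of "v k" "q k"] Cons.prems k by (cases "q k = 0") auto
  have head: "B vac (v k) * (r powi (- ?s) * correlator ks v x)
      = r powi (- (\<Sum>k\<in>set (k # ks). q k)) * (B vac (v k) * correlator ks v x)"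
    by (metis 2 mult.assoc mult.commute)
  have 3: "inverse (r * x k - r * x j) ^ Suc i
         * correlator ks (v(j := Y (v k) (int i) (v j))) (\<lambda>k. r * x k)
      = r powi (- (\<Sum>k\<in>set (k # ks). q k)) * (inverse (x k - x j) ^ Suc i
         * correlator ks (v(j := Y (v k) (int i) (v j))) x)" if j: "j \<in> set ks" for i j
  proof -
    let ?q = "q(j := q k + q j - int i - 1)"
    have sum: "(\<Sum>k\<in>set ks. ?q k) = ?s + q k - int i - 1"
      using j by (simp add: sum.remove[of "set ks" j])
    have "correlator ks (v(j := Y (v k) (int i) (v j))) (\<lambda>k. r * x k)
        = r powi (- (\<Sum>k\<in>set ks. ?q k)) * correlator ks (v(j := Y (v k) (int i) (v j))) x"
      by (rule Cons.IH[where q = ?q, OF _ d]) (use Cons.prems j in \<open>auto intro: wt_mode\<close>)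
    moreover have "r powi (- int (Suc i)) = inverse r ^ Suc i"
      by (simp only: power_int_minus power_int_of_nat power_inverse)
    then have "inverse (r * x k - r * x j) ^ Suc i = r powi (- int (Suc i)) * inverse (x k - x j) ^ Suc i"
      by (simp only: inverse_mult_distrib power_mult_distrib flip: right_diff_distrib)
    moreover have "r powi (- int (Suc i)) * r powi (- (?s + q k - int i - 1))
        = r powi (- (\<Sum>k\<in>set (k # ks). q k))"
      using assms(3) k by (simp add: algebra_simps flip: power_int_add)
    ultimately show ?thesis unfolding sum by (simp add: mult_ac)
  qed
  have fin: "\<exists>N. \<forall>i\<ge>N. f i * correlator ks (v(j := Y (v k) (int i) (v j))) x = 0"
    if "j \<in> set ks" for j and f :: "nat \<Rightarrow> complex"
    using truncation_uniform[of "{v k}" "{v j}"] correlator_zero[OF that] by fastforce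
  have pull: "Sum_any (\<lambda>i. c * f i) = c * Sum_any f" if "\<exists>N. \<forall>i\<ge>N. f i = 0"
    for c :: complex and f :: "nat \<Rightarrow> complex"
  proof -
    from that obtain N where "\<And>i. i \<ge> N \<Longrightarrow> f i = 0" by blast
    then show ?thesis
      by (subst (1 2) Sum_any_eq_lessThan[where N = N]) (auto simp: sum_distrib_left)
  qed
  have "correlator (k # ks) v (\<lambda>k. r * x k)
     = r powi (- (\<Sum>k\<in>set (k # ks). q k)) * (B vac (v k) * correlator ks v x)
     + (\<Sum>j\<in>set ks. r powi (- (\<Sum>k\<in>set (k # ks). q k)) * Sum_any (\<lambda>i. (inverse (x k - x j) ^ Suc i
         * correlator ks (v(j := Y (v k) (int i) (v j))) x)))"
    unfolding correlator.simps 1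
    by (intro arg_cong2[where f = "(+)"] sum.cong refl head) (simp_all only: 3 pull[OF fin])
  then show ?case by (simp add: ring_distribs sum_distrib_left)
qed simp

end

section \<open>Correlators as sums of the mode expansion\<close>

lemma has_sum_product:
  fixes f :: "'a \<Rightarrow> complex" and g :: "'b \<Rightarrow> complex"
  assumes "(f has_sum s) A" "(g has_sum t) C"
  shows "((\<lambda>(a, b). f a * g b) has_sum s * t) (A \<times> C)"
proof (rule has_sum_SigmaI)
  show "((\<lambda>b. case (a, b) of (a, b) \<Rightarrow> f a * g b) has_sum f a * t) C" for a
    using has_sum_cmult_right[OF assms(2), of "f a"] by simp
  show "((\<lambda>a. f a * t) has_sum s * t) A"
    by (rule has_sum_cmult_left[OF assms(1)])
  have f: "(\<lambda>a. norm (f a)) summable_on A" and g: "(\<lambda>b. norm (g b)) summable_on C"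
    using assms by (auto simp flip: summable_on_iff_abs_summable_on_complex
        intro: has_sum_imp_summable)
  have "(\<lambda>p. norm (case p of (a, b) \<Rightarrow> f a * g b)) summable_on (A \<times> C)"
    unfolding Infinite_Sum.abs_summable_on_Sigma_iff
    using f g by (auto simp: norm_mult abs_mult infsum_cmult_right' summable_on_cmult_right
        intro!: summable_on_cmult_left)
  then show "(\<lambda>(a, b). f a * g b) summable_on A \<times> C"
    by (rule abs_summable_summable)
qed

lemma has_sum_finite_sum:
  fixes f :: "'i \<Rightarrow> 'a \<Rightarrow> 'b::topological_comm_monoid_add"
  assumes "\<And>i. i \<in> I \<Longrightarrow> (f i has_sum s i) A"
  shows "((\<lambda>a. \<Sum>i\<in>I. f i a) has_sum (\<Sum>i\<in>I. s i)) A"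
  using assms by (induction I rule: infinite_finite_induct) (auto intro: has_sum_add)

lemma negative_binomial_series:
  fixes w :: complex
  assumes "norm w < 1"
  shows "((\<lambda>n. of_nat ((n + i) choose i) * w ^ n) has_sum inverse (1 - w) ^ Suc i) UNIV"
proof (rule norm_summable_imp_has_sum)
  have coeff: "((- of_nat (Suc i)) gchoose n) * (- z) ^ n = of_nat ((n + i) choose i) * z ^ n"
    for z :: "'c::field_char_0" and n
  proof -
    have "(- of_nat (Suc i) :: 'c) gchoose n = (-1) ^ n * (of_nat (i + n) gchoose n)"
      unfolding gbinomial_minus by (simp add: add.commute)
    also have "(of_nat (i + n) gchoose n :: 'c) = of_nat ((n + i) choose i)"
      unfolding binomial_gbinomial[symmetric] using binomial_symmetric[of i "n + i"]
      by (simp add: add.commute)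
    finally show ?thesis by (simp add: power_minus[of z] mult_ac)
  qed
  have nz: "1 - w \<noteq> 0" using assms by auto
  have "(1 + - w) powr (- of_nat (Suc i)) = inverse (1 - w) ^ Suc i"
    using nz powr_nat'[of "1 - w" "Suc i"] by (simp add: powr_minus power_inverse del: of_nat_Suc power_Suc)
  then show "(\<lambda>n. of_nat ((n + i) choose i) * w ^ n) sums inverse (1 - w) ^ Suc i"
    using gen_binomial_complex[of "- w" "- of_nat (Suc i)"] assms by (simp only: coeff norm_minus_cancel)
  have "summable (\<lambda>n. of_nat ((n + i) choose i) * norm w ^ n)"
    using gen_binomial_real[of "- norm w" "- of_nat (Suc i)"] assms
    by (simp only: coeff abs_minus_cancel) (auto simp: summable_def)
  then show "summable (\<lambda>n. norm (of_nat ((n + i) choose i) * w ^ n))"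
    by (simp add: norm_mult norm_power)
qed

text \<open>
  This is where the poles of the recursion come from. The sum runs over all integers,
  to match the range of the mode index.
\<close>
lemma inverse_power_expansion:
  fixes z w :: complex
  assumes "norm w < norm z"
  shows "((\<lambda>M::int. if M \<ge> int i then of_nat (nat M choose i) * z powi (- M - 1) * w powi (M - int i) else 0)
    has_sum inverse (z - w) ^ Suc i) UNIV"
proof -
  have z: "z \<noteq> 0" using assms by auto
  have "norm (w / z) < 1" using assms by (simp add: norm_divide divide_less_eq)
  then have "((\<lambda>n. inverse z ^ Suc i * (of_nat ((n + i) choose i) * (w / z) ^ n))
      has_sum inverse z ^ Suc i * inverse (1 - w / z) ^ Suc i) UNIV"
    by (intro has_sum_cmult_right negative_binomial_series)
  also have "inverse z ^ Suc i * inverse (1 - w / z) ^ Suc i = inverse (z - w) ^ Suc i"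
    using z by (simp only: power_mult_distrib[symmetric] inverse_mult_distrib[symmetric])
      (simp add: right_diff_distrib)
  also have "(\<lambda>n. inverse z ^ Suc i * (of_nat ((n + i) choose i) * (w / z) ^ n))
     = (\<lambda>n. of_nat (nat (int (n + i)) choose i) * z powi (- int (n + i) - 1) * w powi (int (n + i) - int i))"
  proof
    fix n
    have "z powi (- int (n + i) - 1) = z powi (- int (n + Suc i))" by simp
    also have "\<dots> = inverse z ^ (n + Suc i)"
      by (simp only: power_int_minus power_int_of_nat power_inverse)
    finally have "z powi (- int (n + i) - 1) = inverse z ^ (n + Suc i)" .
    then show "inverse z ^ Suc i * (of_nat ((n + i) choose i) * (w / z) ^ n)
     = of_nat (nat (int (n + i)) choose i) * z powi (- int (n + i) - 1) * w powi (int (n + i) - int i)"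
      by (simp add: power_add power_divide field_simps nat_int_add)
  qed
  also have "(\<dots> has_sum inverse (z - w) ^ Suc i) UNIV \<longleftrightarrow>
     ((\<lambda>M. of_nat (nat M choose i) * z powi (- M - 1) * w powi (M - int i))
        has_sum inverse (z - w) ^ Suc i) {int i..}"
    by (rule has_sum_reindex_bij_witness[where j = "\<lambda>n. int (n + i)" and i = "\<lambda>M. nat (M - int i)"]) auto
  also have "\<dots> \<longleftrightarrow> ?thesis"
    by (rule has_sum_cong_neutral) auto
  finally show ?thesis .
qed

context cft_voa
begin

definition apply_modes :: "nat list \<Rightarrow> (nat \<Rightarrow> 'v) \<Rightarrow> (nat \<Rightarrow> int) \<Rightarrow> 'v" where
  "apply_modes ks v m = foldr (\<lambda>k w. Y (v k) (m k) w) ks vac"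

lemma apply_modes_simps [simp]:
  "apply_modes [] v m = vac"
  "apply_modes (k # ks) v m = Y (v k) (m k) (apply_modes ks v m)"
  by (simp_all add: apply_modes_def)

lemma apply_modes_cong:
  assumes "\<And>k. k \<in> set ks \<Longrightarrow> v k = v' k" "\<And>k. k \<in> set ks \<Longrightarrow> m k = m' k"
  shows "apply_modes ks v m = apply_modes ks v' m'"
  using assms by (induction ks) auto

text \<open>
  Needed when the last point is \<open>0\<close>: negative powers of that point then occur only with
  coefficient \<open>0\<close>.
\<close>
lemma apply_modes_last_nonneg:
  assumes "ks \<noteq> []" "m (last ks) \<ge> 0"
  shows "apply_modes ks v m = 0"
  using assms by (induction ks) (auto simp: creation split: if_splits)

text \<open>
  A nonnegative mode is moved to the right through all fields until it kills the vacuum;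
  each commutator replaces one vector \<open>v\<^sub>j\<close> by \<open>u\<^sub>i v\<^sub>j\<close>.
\<close>
lemma mode_apply_modes:
  assumes "distinct ks"
  shows "Y u (int M) (apply_modes ks v m) =
    (\<Sum>j\<in>set ks. \<Sum>i\<le>M. smul (of_nat (M choose i))
       (apply_modes ks (v(j := Y u (int i) (v j))) (m(j := int M + m j - int i))))"
  using assms
proof (induction ks)
  case Nil
  then show ?case by (simp add: creation)
next
  case (Cons k ks)
  then have k: "k \<notin> set ks" and d: "distinct ks" by auto
  have tail: "apply_modes ks (v(k := w)) (m(k := p)) = apply_modes ks v m" for w p
    by (rule apply_modes_cong) (use k in auto)
  have neq: "j \<noteq> k" if "j \<in> set ks" for j using that k by auto
  have "Y (v k) (m k) (Y u (int M) (apply_modes ks v m)) =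
    (\<Sum>j\<in>set ks. \<Sum>i\<le>M. smul (of_nat (M choose i))
       (apply_modes (k # ks) (v(j := Y u (int i) (v j))) (m(j := int M + m j - int i))))"
    unfolding Cons.IH[OF d] mode_sum_right mode_linear_right
    by (intro sum.cong refl) (auto dest: neq)
  moreover have "(\<Sum>i\<le>M. smul (of_nat (M choose i)) (Y (Y u (int i) (v k)) (int M + m k - int i) (apply_modes ks v m)))
     = (\<Sum>i\<le>M. smul (of_nat (M choose i))
       (apply_modes (k # ks) (v(k := Y u (int i) (v k))) (m(k := int M + m k - int i))))"
    by (simp add: tail)
  ultimately show "Y u (int M) (apply_modes (k # ks) v m) =
    (\<Sum>j\<in>set (k # ks). \<Sum>i\<le>M. smul (of_nat (M choose i))
       (apply_modes (k # ks) (v(j := Y u (int i) (v j))) (m(j := int M + m j - int i))))"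
    unfolding list.set sum.insert[OF finite_set k] apply_modes_simps(2)[of k ks v m] mode_commutator_nat
    by (simp only: add.commute)
qed

definition mode_term :: "nat list \<Rightarrow> (nat \<Rightarrow> 'v) \<Rightarrow> (nat \<Rightarrow> complex) \<Rightarrow> (nat \<Rightarrow> int) \<Rightarrow> complex" where
  "mode_term ks v x m = B vac (apply_modes ks v m) * (\<Prod>k\<in>set ks. x k powi (- m k - 1))"

text \<open>
  The termwise form of the recursion for correlators. The sum over \<open>i \<le> M\<close> from the
  commutators is cut at a bound independent of \<open>M\<close>, so that the summation over \<open>M\<close> can be
  carried out for each \<open>i\<close> separately.
\<close>
lemma mode_term_Cons:
  assumes "distinct (k # ks)"
    and N: "\<And>j i. j \<in> set ks \<Longrightarrow> i \<ge> N \<Longrightarrow> Y (v k) (int i) (v j) = 0"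
  shows "mode_term (k # ks) v x (m(k := M)) =
    (if M = -1 then B vac (v k) else 0) * mode_term ks v x m
    + (\<Sum>j\<in>set ks. \<Sum>i<N. if M \<ge> int i
         then of_nat (nat M choose i) * x k powi (- M - 1)
           * (B vac (apply_modes ks (v(j := Y (v k) (int i) (v j))) (m(j := M + m j - int i)))
              * (\<Prod>l\<in>set ks. x l powi (- m l - 1)))
         else 0)"
proof -
  have k: "k \<notin> set ks" and d: "distinct ks" using assms(1) by auto
  let ?P = "\<Prod>l\<in>set ks. x l powi (- m l - 1)"
  have prod: "(\<Prod>l\<in>set ks. x l powi (- (m(k := M)) l - 1)) = ?P"
    by (rule prod.cong) (use k in auto)
  have tail: "apply_modes ks v (m(k := M)) = apply_modes ks v m"
    by (rule apply_modes_cong) (use k in auto)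
  have lhs: "mode_term (k # ks) v x (m(k := M))
     = B vac (Y (v k) M (apply_modes ks v m)) * (x k powi (- M - 1) * ?P)"
    using k prod by (simp add: mode_term_def tail)
  show ?thesis
  proof (cases "M < 0")
    case True
    then show ?thesis unfolding lhs form_vac_negative_mode[OF True]
      by (auto simp: mode_term_def)
  next
    case False
    then obtain p where p: "M = int p" using nonneg_int_cases[of M] by auto
    have zero: "apply_modes ks (v(j := 0)) m' = 0" if "j \<in> set ks" for j m'
      using that d
    proof (induction ks)
      case (Cons a ks)
      then show ?case by (cases "a = j") auto
    qed simp
    have inner: "(\<Sum>i\<le>p. of_nat (p choose i) * B vac (apply_modes ks (v(j := Y (v k) (int i) (v j))) (m(j := int p + m j - int i))))
      = (\<Sum>i<N. if int i \<le> M then of_nat (p choose i) * B vac (apply_modes ks (v(j := Y (v k) (int i) (v j))) (m(j := int p + m j - int i))) else 0)"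
      if "j \<in> set ks" for j
    proof (rule sum.mono_neutral_cong)
      show "of_nat (p choose i) * B vac (apply_modes ks (v(j := Y (v k) (int i) (v j))) (m(j := int p + m j - int i))) = 0"
        if "i \<in> {..p} - {..<N}" for i
        using that N[OF \<open>j \<in> set ks\<close>, of i] zero[OF \<open>j \<in> set ks\<close>] by simp
    qed (auto simp: p)
    have "B vac (Y (v k) M (apply_modes ks v m)) = (\<Sum>j\<in>set ks. \<Sum>i<N. if int i \<le> M
        then of_nat (p choose i) * B vac (apply_modes ks (v(j := Y (v k) (int i) (v j))) (m(j := int p + m j - int i))) else 0)"
      unfolding p mode_apply_modes[OF d] form_sum_right form_linear_right
      by (rule sum.cong[OF refl]) (rule inner[unfolded p])
    then show ?thesis unfolding lhs
      using p by (simp add: sum_distrib_right) (intro sum.cong refl, simp)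
  qed
qed

text \<open>
  Each part of the termwise recursion is, after a shift of the mode index of \<open>v\<^sub>j\<close>, a
  product of a one-variable series and a mode expansion with one field less, so absolute
  convergence is inherited from these factors.
\<close>
theorem correlator_has_sum:
  assumes "distinct ks" "sorted_wrt (\<lambda>i j. norm (x i) > norm (x j)) ks"
  shows "(mode_term ks v x has_sum correlator ks v x) (PiE (set ks) (\<lambda>_. UNIV))"
  using assms
proof (induction ks arbitrary: v)
  case Nil
  then show ?case by (simp add: mode_term_def has_sum_finite_iff)
next
  case (Cons k ks)
  then have k: "k \<notin> set ks" and d: "distinct ks" by auto
  let ?S = "PiE (set ks) (\<lambda>_. UNIV :: int set)"
  have IH: "(mode_term ks v x has_sum correlator ks v x) ?S" for v
    using Cons by auto
  obtain N where N: "\<forall>u\<in>{v k}. \<forall>w\<in>v ` set ks. \<forall>i\<ge>N. Y u (int i) w = 0"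
    using truncation_uniform[of "{v k}" "v ` set ks"] by auto
  define T where "T j i = (\<lambda>(M::int, m). if M \<ge> int i
         then of_nat (nat M choose i) * x k powi (- M - 1)
           * (B vac (apply_modes ks (v(j := Y (v k) (int i) (v j))) (m(j := M + m j - int i)))
              * (\<Prod>l\<in>set ks. x l powi (- m l - 1)))
         else 0)" for i j
  have T: "(T j i has_sum inverse (x k - x j) ^ Suc i
      * correlator ks (v(j := Y (v k) (int i) (v j))) x) (UNIV \<times> ?S)" if j: "j \<in> set ks" for i j
  proof -
    let ?v = "v(j := Y (v k) (int i) (v j))"
    have nkj: "norm (x j) < norm (x k)" using Cons.prems j by auto
    have "((\<lambda>(M, m). (if M \<ge> int i then of_nat (nat M choose i) * x k powi (- M - 1) * x j powi (M - int i) else 0)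
         * mode_term ks ?v x m)
        has_sum inverse (x k - x j) ^ Suc i * correlator ks ?v x) (UNIV \<times> ?S)"
      by (intro has_sum_product inverse_power_expansion nkj IH)
    also have "?this \<longleftrightarrow> ?thesis"
    proof (rule has_sum_reindex_bij_witness[where
          j = "\<lambda>(M, m). (M, m(j := m j - M + int i))" and i = "\<lambda>(M, m). (M, m(j := m j + M - int i))"])
      fix a :: "int \<times> (nat \<Rightarrow> int)" assume "a \<in> UNIV \<times> ?S"
      obtain M m where a: "a = (M, m)" by force
      show "T j i (case a of (M, m) \<Rightarrow> (M, m(j := m j - M + int i))) =
         (case a of (M, m) \<Rightarrow> (if M \<ge> int i then of_nat (nat M choose i) * x k powi (- M - 1) * x j powi (M - int i) else 0)
         * mode_term ks ?v x m)"
      proof (cases "M \<ge> int i \<and> apply_modes ks ?v m \<noteq> 0")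
        case True
        have "x j powi (- (m j - M + int i) - 1) = x j powi (M - int i) * x j powi (- m j - 1)"
        proof (cases "x j = 0")
          case False
          have "- (m j - M + int i) - 1 = (M - int i) + (- m j - 1)" by simp
          then show ?thesis by (simp only:) (rule power_int_add, use False in simp)
        next
          \<comment> \<open>The power law for exponents fails at \<open>0\<close>; here it is needed only for nonnegative exponents.\<close>
          case j0: True
          have "j = last ks"
          proof (rule ccontr)
            assume "j \<noteq> last ks"
            moreover have eq: "butlast ks @ [last ks] = ks" using j by (cases ks) auto
            have "sorted_wrt (\<lambda>i j. norm (x i) > norm (x j)) (butlast ks @ [last ks])"
              unfolding eq using Cons.prems(2) by simp
            moreover have "set ks = insert (last ks) (set (butlast ks))"
              using arg_cong[OF eq, of set] by simp
            ultimately have "norm (x j) > norm (x (last ks))"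
              using j unfolding sorted_wrt_append by auto
            then show False using j0 by simp
          qed
          then have "m j < 0" using apply_modes_last_nonneg[of ks m ?v] True j by force
          then have "- m j - 1 \<ge> 0" "M - int i \<ge> 0" using True by auto
          then obtain p q where "M - int i = int p" "- m j - 1 = int q"
            by (metis nonneg_int_cases)
          moreover from this have "- (m j - M + int i) - 1 = int (p + q)" by simp
          ultimately show ?thesis by (simp only: power_int_of_nat power_add)
        qed
        moreover have "(\<Prod>l\<in>set ks - {j}. x l powi (- (m(j := p)) l - 1)) = (\<Prod>l\<in>set ks - {j}. x l powi (- m l - 1))" for p
          by (rule prod.cong) auto
        ultimately show ?thesis using True j
          by (simp add: a T_def mode_term_def prod.remove[of "set ks" j] mult_ac)
      qed (auto simp: a T_def mode_term_def)
    qed (use j in \<open>auto simp: PiE_iff extensional_def\<close>)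
    finally show ?thesis .
  qed
  have T0: "((\<lambda>(M::int, m). (if M = -1 then B vac (v k) else 0) * mode_term ks v x m)
      has_sum B vac (v k) * correlator ks v x) (UNIV \<times> ?S)"
    by (intro has_sum_product[OF has_sum_finite_neutralI[where B = "{-1}"]] IH) auto
  have expand: "correlator (k # ks) v x = B vac (v k) * correlator ks v x
     + (\<Sum>j\<in>set ks. \<Sum>i<N. inverse (x k - x j) ^ Suc i
          * correlator ks (v(j := Y (v k) (int i) (v j))) x)"
    by (rule correlator_Cons) (use N in auto)
  have "((\<lambda>a. (case a of (M, m) \<Rightarrow> (if M = -1 then B vac (v k) else 0) * mode_term ks v x m)
        + (\<Sum>j\<in>set ks. \<Sum>i<N. T j i a))
      has_sum correlator (k # ks) v x) (UNIV \<times> ?S)"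
    unfolding expand by (intro has_sum_add has_sum_finite_sum T T0)
  also have "(\<lambda>a. (case a of (M, m) \<Rightarrow> (if M = -1 then B vac (v k) else 0) * mode_term ks v x m)
        + (\<Sum>j\<in>set ks. \<Sum>i<N. T j i a))
     = (\<lambda>a. mode_term (k # ks) v x ((\<lambda>(M, m). m(k := M)) a))"
  proof
    fix a :: "int \<times> (nat \<Rightarrow> int)"
    obtain M m where a: "a = (M, m)" by force
    show "(case a of (M, m) \<Rightarrow> (if M = -1 then B vac (v k) else 0) * mode_term ks v x m)
        + (\<Sum>j\<in>set ks. \<Sum>i<N. T j i a) = mode_term (k # ks) v x ((\<lambda>(M, m). m(k := M)) a)"
      unfolding a prod.case T_def
      by (rule mode_term_Cons[OF Cons.prems(1), symmetric]) (use N in auto)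
  qed
  also have "(\<dots> has_sum correlator (k # ks) v x) (UNIV \<times> ?S) \<longleftrightarrow>
      (mode_term (k # ks) v x has_sum correlator (k # ks) v x) (PiE (set (k # ks)) (\<lambda>_. UNIV))"
  proof (rule has_sum_reindex_bij_betw)
    show "bij_betw (\<lambda>(M, m). m(k := M)) (UNIV \<times> ?S) (PiE (set (k # ks)) (\<lambda>_. UNIV))"
      unfolding bij_betw_def using inj_combinator[OF k, of "\<lambda>_. UNIV"]
        PiE_insert_eq[of k "set ks" "\<lambda>_. UNIV :: int set"] by simp
  qed
  finally show ?case .
qed

end

section \<open>Partial fractions\<close>

text \<open>
  In the application \<open>a = 1/(x - y)\<close>, \<open>b = 1/y\<close> and \<open>c = 1/x\<close>. The hypothesis
  replaces \<open>ab\<close> by \<open>c(a + b)\<close>; both sides satisfy the recursion that results, the right one by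
  Pascal's rule, and the two sums are interchanged by the symmetry between \<open>(a, s)\<close> and \<open>(b, p)\<close>.
\<close>
lemma partial_fractions:
  fixes a b c :: "'a::comm_ring_1"
  assumes abc: "a * b = c * a + c * b"
  shows "a ^ Suc s * b ^ Suc p =
    (\<Sum>i\<le>p. of_nat ((s + i) choose s) * c ^ Suc (s + i) * b ^ Suc (p - i))
    + (\<Sum>i\<le>s. of_nat ((p + i) choose p) * c ^ Suc (p + i) * a ^ Suc (s - i))"
proof -
  define S where "S b s p = (\<Sum>i\<le>p. of_nat ((s + i) choose s) * c ^ Suc (s + i) * b ^ Suc (p - i))"
    for b :: 'a and s p
  have base: "a * b ^ Suc p = S b 0 p + c ^ Suc p * a" if "a * b = c * a + c * b" for a b p
  proof (induction p)
    case 0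
    then show ?case using that by (simp add: S_def add.commute)
  next
    case (Suc p)
    have "S b 0 (Suc p) = b * S b 0 p + c ^ Suc (Suc p) * b"
      unfolding S_def sum.atMost_Suc sum_distrib_left
      by (simp add: Suc_diff_le mult_ac)
    moreover have "a * b ^ Suc (Suc p) = b * (S b 0 p + c ^ Suc p * a)"
      unfolding Suc[symmetric] by (simp add: mult_ac)
    moreover have "b * (c ^ Suc p * a) = c ^ Suc p * (c * a + c * b)"
      unfolding that[symmetric] by (simp add: mult_ac)
    ultimately show ?case by (simp add: algebra_simps)
  qed
  have pascal: "S b (Suc s) (Suc p) = c * S b s (Suc p) + c * S b (Suc s) p" for b s p
  proof -
    have shift: "c * S b (Suc s) p = (\<Sum>i\<le>Suc p. of_nat ((s + i) choose Suc s) * c ^ Suc (Suc s + i) * b ^ Suc (Suc p - i))"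
      unfolding S_def sum_distrib_left by (subst sum.atMost_Suc_shift) (simp add: mult_ac binomial_eq_0)
    show ?thesis
      unfolding shift unfolding S_def sum_distrib_left sum.distrib[symmetric]
      by (intro sum.cong refl) (simp add: algebra_simps)
  qed
  have S0: "S b s 0 = c ^ Suc s * b" for b s by (simp add: S_def)
  have "a ^ Suc s * b ^ Suc p = S b s p + S a p s"
  proof (induction s arbitrary: p)
    case 0
    then show ?case using base[OF abc] by (simp add: S0)
  next
    case (Suc s)
    show ?case
    proof (induction p)
      case 0
      have "b * a = c * b + c * a" using abc by (simp add: mult.commute add.commute)
      from base[OF this, of "Suc s"] show ?case by (simp add: S0 mult.commute add.commute)
    next
      case (Suc p)
      have "a ^ Suc (Suc s) * b ^ Suc (Suc p) = (a * b) * (a ^ Suc s * b ^ Suc p)"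
        by (simp add: mult_ac)
      also have "\<dots> = c * (a ^ Suc (Suc s) * b ^ Suc p) + c * (a ^ Suc s * b ^ Suc (Suc p))"
        unfolding abc by (simp add: algebra_simps)
      also have "\<dots> = c * (S b (Suc s) p + S a p (Suc s)) + c * (S b s (Suc p) + S a (Suc p) s)"
        by (simp only: Suc \<open>\<And>p. a ^ Suc s * b ^ Suc p = S b s p + S a p s\<close>)
      also have "\<dots> = S b (Suc s) (Suc p) + S a (Suc p) (Suc s)"
        unfolding pascal by (simp add: algebra_simps)
      finally show ?case .
    qed
  qed
  then show ?thesis unfolding S_def .
qed

text \<open>
  The same identity tested against a finitely supported array \<open>E\<close>, re-indexed so that the
  inner sums have the shape in which the commutator formula and skew-symmetry produce them.
  The range \<open>2N\<close> accommodates the largest index \<open>s + k\<close> with \<open>s, k < N\<close>.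
\<close>
lemma partial_fractions_sum:
  fixes a b c :: "'a::comm_ring_1"
  assumes abc: "a * b = c * a + c * b"
    and E: "\<And>s p. s \<ge> N \<or> p \<ge> N \<Longrightarrow> E s p = 0"
  shows "(\<Sum>s<N. \<Sum>p<N. a ^ Suc s * b ^ Suc p * E s p) =
    (\<Sum>i<2*N. \<Sum>l<2*N. c ^ Suc i * b ^ Suc l * (\<Sum>s\<le>i. of_nat (i choose s) * E s (i + l - s)))
    + (\<Sum>i<2*N. \<Sum>l<2*N. a ^ Suc i * c ^ Suc l * (\<Sum>t\<le>l. of_nat (l choose t) * E (i + t) (l - t)))"
proof -
  let ?D = "SIGMA s:{..<N}. SIGMA p:{..<N}. {..p}"
  let ?D' = "SIGMA s:{..<N}. SIGMA p:{..<N}. {..s}"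
  let ?I = "SIGMA i:{..<2*N}. SIGMA l:{..<2*N}. {..i}"
  let ?J = "SIGMA i:{..<2*N}. SIGMA l:{..<2*N}. {..l}"
  have choose_add: "(p + k) choose p = (p + k) choose k" for p k
    using binomial_symmetric[of p "p + k"] by simp
  have Z: "s < N \<and> p < N" if "x * (y * E s p) \<noteq> 0" for x y s p
    using that by (metis E mult_zero_right not_less)
  have "(\<Sum>s<N. \<Sum>p<N. a ^ Suc s * b ^ Suc p * E s p) =
     (\<Sum>(s, p, k)\<in>?D. of_nat ((s + k) choose s) * c ^ Suc (s + k) * b ^ Suc (p - k) * E s p)
     + (\<Sum>(s, p, k)\<in>?D'. of_nat ((p + k) choose p) * c ^ Suc (p + k) * a ^ Suc (s - k) * E s p)"
    by (simp add: partial_fractions[OF abc] ring_distribs sum.distrib sum_distrib_right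
        flip: sum.Sigma del: power_Suc)
  also have "(\<Sum>(s, p, k)\<in>?D. of_nat ((s + k) choose s) * c ^ Suc (s + k) * b ^ Suc (p - k) * E s p)
     = (\<Sum>(i, l, s)\<in>{(i, l, s)\<in>?I. s < N \<and> i + l - s < N}. c ^ Suc i * b ^ Suc l * (of_nat (i choose s) * E s (i + l - s)))"
    by (rule sum.reindex_bij_witness[where i = "\<lambda>(i, l, s). (s, i + l - s, i - s)"
          and j = "\<lambda>(s, p, k). (s + k, p - k, s)"]) (auto simp: mult_ac)
  also have "\<dots> = (\<Sum>(i, l, s)\<in>?I. c ^ Suc i * b ^ Suc l * (of_nat (i choose s) * E s (i + l - s)))"
  proof (rule sum.mono_neutral_left)
    show "\<forall>x\<in>?I - {(i, l, s)\<in>?I. s < N \<and> i + l - s < N}.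
        (case x of (i, l, s) \<Rightarrow> c ^ Suc i * b ^ Suc l * (of_nat (i choose s) * E s (i + l - s))) = 0"
      by (rule ballI, clarify, drule Z, simp)
  qed auto
  also have "(\<Sum>(s, p, k)\<in>?D'. of_nat ((p + k) choose p) * c ^ Suc (p + k) * a ^ Suc (s - k) * E s p)
     = (\<Sum>(i, l, t)\<in>{(i, l, t)\<in>?J. i + t < N \<and> l - t < N}. a ^ Suc i * c ^ Suc l * (of_nat (l choose t) * E (i + t) (l - t)))"
    by (rule sum.reindex_bij_witness[where i = "\<lambda>(i, l, t). (i + t, l - t, t)"
          and j = "\<lambda>(s, p, k). (s - k, p + k, k)"])
      (auto simp: mult_ac, metis choose_add)
  also have "\<dots> = (\<Sum>(i, l, t)\<in>?J. a ^ Suc i * c ^ Suc l * (of_nat (l choose t) * E (i + t) (l - t)))"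
  proof (rule sum.mono_neutral_left)
    show "\<forall>x\<in>?J - {(i, l, t)\<in>?J. i + t < N \<and> l - t < N}.
        (case x of (i, l, t) \<Rightarrow> a ^ Suc i * c ^ Suc l * (of_nat (l choose t) * E (i + t) (l - t))) = 0"
      by (rule ballI, clarify, drule Z, simp)
  qed auto
  finally show ?thesis
    by (simp add: sum_distrib_left flip: sum.Sigma del: power_Suc)
qed

section \<open>Permutation symmetry of correlators\<close>

context cft_voa
begin

lemma iterate_commutator:
  "Y u (int i) (Y w (int l) e) = Y w (int l) (Y u (int i) e)
    + (\<Sum>s\<le>i. smul (of_nat (i choose s)) (Y (Y u (int s) w) (int (i + l - s)) e))"
proof -
  have "(\<Sum>s\<le>i. smul (of_nat (i choose s)) (Y (Y u (int s) w) (int i + int l - int s) e))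
     = (\<Sum>s\<le>i. smul (of_nat (i choose s)) (Y (Y u (int s) w) (int (i + l - s)) e))"
    by (rule sum.cong[OF refl]) (simp add: of_nat_diff)
  then show ?thesis using mode_commutator_nat[of u i w "int l" e] by simp
qed

lemma iterate_skew:
  "Y (Y w (int i) u) (int l) e
    = smul (- ((-1) ^ i)) (\<Sum>t\<le>l. smul (of_nat (l choose t)) (Y (Y u (int (i + t)) w) (int (l - t)) e))"
proof -
  have "Sum_any (\<lambda>t::nat. smul (of_int (int l) gchoose t) (Y (Y u (int i + int t) w) (int l - int t) e))
     = (\<Sum>t\<le>l. smul (of_nat (l choose t)) (Y (Y u (int (i + t)) w) (int (l - t)) e))"
    by (subst Sum_any_eq_lessThan[where N = "Suc l"])
       (auto simp: binomial_gbinomial[symmetric] lessThan_Suc_atMost of_nat_diff intro!: sum.cong)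
  then show ?thesis using skew_symmetry[of w "int i" u "int l" e] by simp
qed

text \<open>
  Skew-symmetry for \<open>(w\<^sub>i u)\<^bsub>-1\<^esub> 1 = w\<^sub>i u\<close>. Only the leading term survives, since the modes below
  \<open>-1\<close> are annihilated by \<open>\<langle>1, \<cdot>\<rangle>\<close>.
\<close>
lemma form_vac_skew: "B vac (Y w (int i) u) = - ((-1) ^ i) * B vac (Y u (int i) w)"
proof -
  obtain N where N: "\<And>n. n \<ge> N \<Longrightarrow> Y u n w = 0" using truncation by blast
  have "Y (Y w (int i) u) (- 1) vac = smul (- ((-1) ^ i))
     (\<Sum>t<nat N. smul (of_int (- 1) gchoose t) (Y (Y u (int i + int t) w) (- 1 - int t) vac))"
    unfolding skew_symmetry[of w "int i" u "- 1" vac]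
    by (subst Sum_any_eq_lessThan[where N = "nat N"]) (auto simp: N)
  then have "B vac (Y (Y w (int i) u) (- 1) vac) = - ((-1) ^ i) *
     (\<Sum>t<nat N. (of_int (- 1) gchoose t) * B vac (Y (Y u (int i + int t) w) (- 1 - int t) vac))"
    by (simp only: form_linear_right form_sum_right)
  also have "(\<Sum>t<nat N. (of_int (- 1) gchoose t) * B vac (Y (Y u (int i + int t) w) (- 1 - int t) vac))
     = (\<Sum>t<nat N. if t = 0 then B vac (Y u (int i) w) else 0)"
    by (rule sum.cong[OF refl]) (auto simp: form_vac_negative_mode)
  also have "\<dots> = B vac (Y u (int i) w)"
    using N[of "int i"] by (auto simp: not_less)
  finally show ?thesis by (simp add: creation')
qed

text \<open>
  The contributions to a correlator in which \<open>u\<close> (at distance \<open>x\<close>) and \<open>w\<close> (at distance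
  \<open>y\<close>) both act on the same vector \<open>e\<close>, for either order of \<open>u\<close> and \<open>w\<close>. Written through
  \<open>(u\<^sub>s w)\<^sub>p e\<close>, the difference of the two sides is a linear combination of partial fraction
  identities.
\<close>
lemma site_identity:
  fixes \<phi> :: "'v \<Rightarrow> complex" and x y :: complex
  assumes add: "\<And>p q. \<phi> (p + q) = \<phi> p + \<phi> q" and smul: "\<And>r p. \<phi> (smul r p) = r * \<phi> p"
    and xy: "x \<noteq> 0" "y \<noteq> 0" "x \<noteq> y"
    and vanish: "\<And>s p. s \<ge> N \<or> p \<ge> N \<Longrightarrow> Y (Y u (int s) w) (int p) e = 0"
  shows "(\<Sum>i<2*N. \<Sum>l<2*N. inverse (x - y) ^ Suc i * inverse y ^ Suc l * \<phi> (Y (Y u (int i) w) (int l) e))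
      + (\<Sum>i<2*N. \<Sum>l<2*N. inverse x ^ Suc i * inverse y ^ Suc l * \<phi> (Y w (int l) (Y u (int i) e)))
    = (\<Sum>i<2*N. \<Sum>l<2*N. inverse (y - x) ^ Suc i * inverse x ^ Suc l * \<phi> (Y (Y w (int i) u) (int l) e))
      + (\<Sum>i<2*N. \<Sum>l<2*N. inverse x ^ Suc i * inverse y ^ Suc l * \<phi> (Y u (int i) (Y w (int l) e)))"
    (is "?S1 + ?S2 = ?S3 + ?S4")
proof -
  define E where "E s p = \<phi> (Y (Y u (int s) w) (int p) e)" for s p
  have zero: "\<phi> 0 = 0" using smul[of 0 0] by simp
  have sum: "\<phi> (sum f S) = (\<Sum>i\<in>S. \<phi> (f i))" for f and S :: "nat set"
    by (induction S rule: infinite_finite_induct) (simp_all add: zero add)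
  have E: "E s p = 0" if "s \<ge> N \<or> p \<ge> N" for s p
    using vanish[OF that] zero by (simp add: E_def)
  have comm: "\<phi> (Y u (int i) (Y w (int l) e)) = \<phi> (Y w (int l) (Y u (int i) e))
      + (\<Sum>s\<le>i. of_nat (i choose s) * E s (i + l - s))" for i l
    unfolding iterate_commutator[of u i w l e] E_def add sum smul ..
  have skew: "\<phi> (Y (Y w (int i) u) (int l) e)
      = - ((-1) ^ i) * (\<Sum>t\<le>l. of_nat (l choose t) * E (i + t) (l - t))" for i l
    unfolding iterate_skew[of w i u l e] E_def smul sum ..
  have sign: "inverse (y - x) ^ Suc i = - ((-1) ^ i) * inverse (x - y) ^ Suc i" for i
  proof -
    have "inverse (y - x) = (-1) * inverse (x - y)"
      using inverse_minus_eq[of "x - y"] by simp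
    then show ?thesis by (simp only: power_mult_distrib) simp
  qed
  have "(-1) ^ i * (-1) ^ i = (1::complex)" for i :: nat
    by (simp flip: power_mult_distrib)
  then have S3: "?S3 = (\<Sum>i<2*N. \<Sum>l<2*N. inverse (x - y) ^ Suc i * inverse x ^ Suc l
        * (\<Sum>t\<le>l. of_nat (l choose t) * E (i + t) (l - t)))"
    unfolding skew sign by (intro sum.cong refl) (simp add: algebra_simps)
  have S4: "?S4 = ?S2 + (\<Sum>i<2*N. \<Sum>l<2*N. inverse x ^ Suc i * inverse y ^ Suc l
        * (\<Sum>s\<le>i. of_nat (i choose s) * E s (i + l - s)))"
    unfolding comm by (simp only: ring_distribs sum.distrib)
  have abc: "inverse (x - y) * inverse y = inverse x * inverse (x - y) + inverse x * inverse y"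
    using xy by (simp add: field_simps)
  have "?S1 = (\<Sum>i<N. \<Sum>l<2*N. inverse (x - y) ^ Suc i * inverse y ^ Suc l * E i l)"
    unfolding E_def[symmetric] by (rule sum.mono_neutral_right) (auto simp: E)
  also have "\<dots> = (\<Sum>i<N. \<Sum>l<N. inverse (x - y) ^ Suc i * inverse y ^ Suc l * E i l)"
    by (intro sum.cong refl sum.mono_neutral_right) (auto simp: E)
  finally have S1: "?S1 = \<dots>" .
  from partial_fractions_sum[where N = N and E = E, OF abc E] show ?thesis
    unfolding S1 S3 S4 by simp
qed

text \<open>
  The recursion applied twice. The terms are grouped by what \<open>u = v k1\<close> and \<open>w = v k2\<close> act on,
  which makes the behaviour of each group under the exchange of \<open>k1\<close> and \<open>k2\<close> visible.
\<close>
lemma correlator_two: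
  assumes d: "distinct (k1 # k2 # ks)"
    and uw: "\<And>i. i \<ge> M \<Longrightarrow> Y (v k1) (int i) (v k2) = 0"
    and uj: "\<And>i j. i \<ge> M \<Longrightarrow> j \<in> set ks \<Longrightarrow> Y (v k1) (int i) (v j) = 0"
    and wj: "\<And>i j. i \<ge> M \<Longrightarrow> j \<in> set ks \<Longrightarrow> Y (v k2) (int i) (v j) = 0"
    and uwj: "\<And>i l j. l \<ge> M \<Longrightarrow> j \<in> set ks \<Longrightarrow> Y (Y (v k1) (int i) (v k2)) (int l) (v j) = 0"
    and wuj: "\<And>i l j. l \<ge> M \<Longrightarrow> j \<in> set ks \<Longrightarrow> Y (v k2) (int l) (Y (v k1) (int i) (v j)) = 0"
  shows "correlator (k1 # k2 # ks) v x =
      B vac (v k1) * B vac (v k2) * correlator ks v x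
    + B vac (v k1) * (\<Sum>j\<in>set ks. \<Sum>l<M. inverse (x k2 - x j) ^ Suc l
        * correlator ks (v(j := Y (v k2) (int l) (v j))) x)
    + B vac (v k2) * (\<Sum>j\<in>set ks. \<Sum>l<M. inverse (x k1 - x j) ^ Suc l
        * correlator ks (v(j := Y (v k1) (int l) (v j))) x)
    + (\<Sum>i<M. inverse (x k1 - x k2) ^ Suc i * B vac (Y (v k1) (int i) (v k2))) * correlator ks v x
    + (\<Sum>j\<in>set ks. \<Sum>i<M. \<Sum>l<M. inverse (x k1 - x k2) ^ Suc i * inverse (x k2 - x j) ^ Suc l
        * correlator ks (v(j := Y (Y (v k1) (int i) (v k2)) (int l) (v j))) x)
    + (\<Sum>j\<in>set ks. \<Sum>j'\<in>set ks. \<Sum>i<M. \<Sum>l<M. inverse (x k1 - x j) ^ Suc i * inverse (x k2 - x j') ^ Suc l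
        * correlator ks (v(j := Y (v k1) (int i) (v j),
            j' := Y (v k2) (int l) ((v(j := Y (v k1) (int i) (v j))) j'))) x)"
proof -
  have k2: "k2 \<notin> set ks" using d by auto
  let ?C = "correlator ks v x"
  define D where "D j l = correlator ks (v(j := Y (v k2) (int l) (v j))) x" for j l
  define G where "G j l = correlator ks (v(j := Y (v k1) (int l) (v j))) x" for j l
  define E where "E j i l = correlator ks (v(j := Y (Y (v k1) (int i) (v k2)) (int l) (v j))) x" for j i l
  define F where "F j i j' l = correlator ks (v(j := Y (v k1) (int i) (v j),
            j' := Y (v k2) (int l) ((v(j := Y (v k1) (int i) (v j))) j'))) x" for j i j' l
  have 1: "correlator (k2 # ks) v x = B vac (v k2) * ?C
      + (\<Sum>j\<in>set ks. \<Sum>l<M. inverse (x k2 - x j) ^ Suc l * D j l)"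
    unfolding D_def by (rule correlator_Cons) (use wj in auto)
  have 2: "correlator (k2 # ks) (v(k2 := Y (v k1) (int i) (v k2))) x
      = B vac (Y (v k1) (int i) (v k2)) * ?C
      + (\<Sum>j\<in>set ks. \<Sum>l<M. inverse (x k2 - x j) ^ Suc l * E j i l)" for i
  proof -
    let ?v = "v(k2 := Y (v k1) (int i) (v k2))"
    have "correlator (k2 # ks) ?v x = B vac (?v k2) * correlator ks ?v x
      + (\<Sum>j\<in>set ks. \<Sum>l<M. inverse (x k2 - x j) ^ Suc l * correlator ks (?v(j := Y (?v k2) (int l) (?v j))) x)"
      by (rule correlator_Cons) (use uwj k2 in auto)
    moreover have "correlator ks (?v(j := Y (?v k2) (int l) (?v j))) x = E j i l" if "j \<in> set ks" for j l
      unfolding E_def by (rule correlator_cong) (use that k2 in auto)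
    moreover have "correlator ks ?v x = ?C" by (rule correlator_upd_notin[OF k2])
    ultimately show ?thesis by simp
  qed
  have 3: "correlator (k2 # ks) (v(j := Y (v k1) (int i) (v j))) x
      = B vac (v k2) * G j i + (\<Sum>j'\<in>set ks. \<Sum>l<M. inverse (x k2 - x j') ^ Suc l * F j i j' l)"
    if j: "j \<in> set ks" for i j
  proof -
    have jk: "j \<noteq> k2" using j k2 by auto
    let ?v = "v(j := Y (v k1) (int i) (v j))"
    have "correlator (k2 # ks) ?v x = B vac (?v k2) * correlator ks ?v x
      + (\<Sum>j'\<in>set ks. \<Sum>l<M. inverse (x k2 - x j') ^ Suc l * correlator ks (?v(j' := Y (?v k2) (int l) (?v j'))) x)"
      by (rule correlator_Cons) (use wuj wj jk in auto)
    then show ?thesis unfolding F_def G_def using jk by simp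
  qed
  have "correlator (k1 # k2 # ks) v x = B vac (v k1) * correlator (k2 # ks) v x
     + (\<Sum>j\<in>set (k2 # ks). \<Sum>i<M. inverse (x k1 - x j) ^ Suc i
         * correlator (k2 # ks) (v(j := Y (v k1) (int i) (v j))) x)"
    by (rule correlator_Cons) (use uw uj in auto)
  also have "\<dots> = B vac (v k1) * correlator (k2 # ks) v x
     + (\<Sum>i<M. inverse (x k1 - x k2) ^ Suc i * correlator (k2 # ks) (v(k2 := Y (v k1) (int i) (v k2))) x)
     + (\<Sum>j\<in>set ks. \<Sum>i<M. inverse (x k1 - x j) ^ Suc i
         * correlator (k2 # ks) (v(j := Y (v k1) (int i) (v j))) x)"
    unfolding list.set sum.insert[OF finite_set k2] by (simp only: add.assoc)
  also have "(\<Sum>i<M. inverse (x k1 - x k2) ^ Suc i * correlator (k2 # ks) (v(k2 := Y (v k1) (int i) (v k2))) x)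
     = (\<Sum>i<M. inverse (x k1 - x k2) ^ Suc i * B vac (Y (v k1) (int i) (v k2))) * ?C
     + (\<Sum>i<M. \<Sum>j\<in>set ks. \<Sum>l<M. inverse (x k1 - x k2) ^ Suc i * inverse (x k2 - x j) ^ Suc l * E j i l)"
    unfolding 2 by (simp only: distrib_left sum.distrib sum_distrib_right sum_distrib_left mult.assoc)
  also have "(\<Sum>i<M. \<Sum>j\<in>set ks. \<Sum>l<M. inverse (x k1 - x k2) ^ Suc i * inverse (x k2 - x j) ^ Suc l * E j i l)
     = (\<Sum>j\<in>set ks. \<Sum>i<M. \<Sum>l<M. inverse (x k1 - x k2) ^ Suc i * inverse (x k2 - x j) ^ Suc l * E j i l)"
    by (rule sum.swap)
  also have "(\<Sum>j\<in>set ks. \<Sum>i<M. inverse (x k1 - x j) ^ Suc i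
         * correlator (k2 # ks) (v(j := Y (v k1) (int i) (v j))) x)
     = (\<Sum>j\<in>set ks. \<Sum>i<M. inverse (x k1 - x j) ^ Suc i
         * (B vac (v k2) * G j i + (\<Sum>j'\<in>set ks. \<Sum>l<M. inverse (x k2 - x j') ^ Suc l * F j i j' l)))"
    by (intro sum.cong refl) (simp only: 3)
  also have "\<dots> = B vac (v k2) * (\<Sum>j\<in>set ks. \<Sum>i<M. inverse (x k1 - x j) ^ Suc i * G j i)
     + (\<Sum>j\<in>set ks. \<Sum>i<M. \<Sum>j'\<in>set ks. \<Sum>l<M. inverse (x k1 - x j) ^ Suc i * inverse (x k2 - x j') ^ Suc l * F j i j' l)"
    by (simp only: distrib_left sum.distrib sum_distrib_left mult.assoc mult.left_commute[of _ "B vac (v k2)"])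
  also have "(\<Sum>j\<in>set ks. \<Sum>i<M. \<Sum>j'\<in>set ks. \<Sum>l<M. inverse (x k1 - x j) ^ Suc i * inverse (x k2 - x j') ^ Suc l * F j i j' l)
     = (\<Sum>j\<in>set ks. \<Sum>j'\<in>set ks. \<Sum>i<M. \<Sum>l<M. inverse (x k1 - x j) ^ Suc i * inverse (x k2 - x j') ^ Suc l * F j i j' l)"
    by (rule sum.cong[OF refl], rule sum.swap)
  finally show ?thesis
    unfolding 1 D_def[symmetric] G_def[symmetric] E_def[symmetric] F_def[symmetric]
    by (simp only: distrib_left mult.assoc add.assoc add.left_commute add.commute)
qed

text \<open>
  In the expansion of \<open>correlator_two\<close>, terms in which the two fields act on different vectors
  are exchanged, the scalar terms agree by \<open>form_vac_skew\<close>, and the terms in which both act on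
  the same vector agree by \<open>site_identity\<close>.
\<close>
lemma correlator_swap_head:
  assumes d: "distinct (k1 # k2 # ks)" and inj: "inj_on x (set (k1 # k2 # ks))"
  shows "correlator (k1 # k2 # ks) v x = correlator (k2 # k1 # ks) v x"
proof -
  let ?u = "v k1" and ?w = "v k2"
  define S where "S = v ` set (k1 # k2 # ks)"
  have S: "?u \<in> S" "?w \<in> S" "\<And>j. j \<in> set ks \<Longrightarrow> v j \<in> S" by (auto simp: S_def)
  have "finite S" by (simp add: S_def)
  then obtain N0 where N0: "\<And>p q i. p \<in> S \<Longrightarrow> q \<in> S \<Longrightarrow> i \<ge> N0 \<Longrightarrow> Y p (int i) q = 0"
    using truncation_uniform[of S S] by blast
  \<comment> \<open>\<open>S'\<close> also contains the vectors produced by one mode, so that the bound covers iterated modes.\<close>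
  define S' where "S' = (\<lambda>(p, i, q). Y p (int i) q) ` (S \<times> {..<N0} \<times> S) \<union> S \<union> {0}"
  have "finite S'" using \<open>finite S\<close> by (simp add: S'_def)
  then obtain N1 where N1: "\<And>p q i. p \<in> S' \<Longrightarrow> q \<in> S' \<Longrightarrow> i \<ge> N1 \<Longrightarrow> Y p (int i) q = 0"
    using truncation_uniform[of S' S'] by blast
  have S'I: "Y p (int i) q \<in> S'" "p \<in> S'" if "p \<in> S" "q \<in> S" for p q i
  proof -
    show "p \<in> S'" using that by (simp add: S'_def)
    show "Y p (int i) q \<in> S'"
    proof (cases "i < N0")
      case True
      then show ?thesis unfolding S'_def using that by (auto intro!: image_eqI[where x = "(p, i, q)"])
    next
      case False
      then show ?thesis using N0 that by (simp add: S'_def)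
    qed
  qed
  define N where "N = max N0 N1"
  have N_mode: "Y p (int i) q = 0" if "p \<in> S" "q \<in> S" "i \<ge> N" for p q i
    using N0 that by (simp add: N_def)
  have N_iterate: "Y (Y p (int j) q) (int i) r = 0" if "p \<in> S" "q \<in> S" "r \<in> S" "i \<ge> N" for p q r i j
    using N1[OF S'I(1)[OF that(1,2), of j] S'I(2)[OF that(3,3)], of i] that(4) by (simp add: N_def)
  have N_compose: "Y r (int i) (Y p (int j) q) = 0" if "p \<in> S" "q \<in> S" "r \<in> S" "i \<ge> N" for p q r i j
    using N1[OF S'I(2)[OF that(3,3)] S'I(1)[OF that(1,2), of j], of i] that(4) by (simp add: N_def)
  have M: "i \<ge> N" if "i \<ge> 2 * N" for i using that by simp
  define \<phi> where "\<phi> j e = correlator ks (v(j := e)) x" for j e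
  have dks: "distinct ks" using d by simp
  define F1 where "F1 j j' = (\<Sum>i<2*N. \<Sum>l<2*N. inverse (x k1 - x j) ^ Suc i * inverse (x k2 - x j') ^ Suc l
        * correlator ks (v(j := Y ?u (int i) (v j),
            j' := Y ?w (int l) ((v(j := Y ?u (int i) (v j))) j'))) x)" for j j'
  define F2 where "F2 j j' = (\<Sum>i<2*N. \<Sum>l<2*N. inverse (x k2 - x j) ^ Suc i * inverse (x k1 - x j') ^ Suc l
        * correlator ks (v(j := Y ?w (int i) (v j),
            j' := Y ?u (int l) ((v(j := Y ?w (int i) (v j))) j'))) x)" for j j'
  define E1 where "E1 j = (\<Sum>i<2*N. \<Sum>l<2*N. inverse (x k1 - x k2) ^ Suc i * inverse (x k2 - x j) ^ Suc l
        * \<phi> j (Y (Y ?u (int i) ?w) (int l) (v j)))" for j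
  define E2 where "E2 j = (\<Sum>i<2*N. \<Sum>l<2*N. inverse (x k2 - x k1) ^ Suc i * inverse (x k1 - x j) ^ Suc l
        * \<phi> j (Y (Y ?w (int i) ?u) (int l) (v j)))" for j
  have off: "F1 j j' = F2 j' j" if "j \<noteq> j'" for j j'
  proof -
    have "v(j := Y ?u (int i) (v j), j' := Y ?w (int l) ((v(j := Y ?u (int i) (v j))) j'))
        = v(j' := Y ?w (int l) (v j'), j := Y ?u (int i) ((v(j' := Y ?w (int l) (v j'))) j))" for i l
      using that by (simp add: fun_upd_twist)
    then show ?thesis unfolding F1_def F2_def
      by (subst sum.swap) (simp only: mult.commute[of "inverse (x k1 - x j) ^ _"])
  qed
  have diag: "E1 j + F1 j j = E2 j + F2 j j" if j: "j \<in> set ks" for j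
  proof -
    have nz: "x k1 - x j \<noteq> 0" "x k2 - x j \<noteq> 0" "x k1 - x j \<noteq> x k2 - x j"
      using inj d j by (auto simp: inj_on_def)
    have add: "\<phi> j (p + q) = \<phi> j p + \<phi> j q" for p q
      using correlator_linear[OF j dks, of v p 1 q x] unfolding \<phi>_def by (simp only: scale_one mult_1)
    have smul: "\<phi> j (smul r p) = r * \<phi> j p" for r p
      unfolding \<phi>_def by (rule correlator_smul[OF j dks])
    have vanish: "Y (Y ?u (int s) ?w) (int p) (v j) = 0" if "s \<ge> N \<or> p \<ge> N" for s p
      using that
    proof
      assume "s \<ge> N"
      then show ?thesis using N_mode[OF S(1,2)] by simp
    next
      assume "p \<ge> N"
      then show ?thesis by (rule N_iterate[OF S(1,2) S(3)[OF j]])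
    qed
    have "x k1 - x j - (x k2 - x j) = x k1 - x k2" "x k2 - x j - (x k1 - x j) = x k2 - x k1" by simp_all
    then have "E1 j + (\<Sum>i<2*N. \<Sum>l<2*N. inverse (x k1 - x j) ^ Suc i * inverse (x k2 - x j) ^ Suc l * \<phi> j (Y ?w (int l) (Y ?u (int i) (v j))))
      = E2 j + (\<Sum>i<2*N. \<Sum>l<2*N. inverse (x k1 - x j) ^ Suc i * inverse (x k2 - x j) ^ Suc l * \<phi> j (Y ?u (int i) (Y ?w (int l) (v j))))"
      using site_identity[of "\<phi> j" "x k1 - x j" "x k2 - x j" N ?u ?w "v j", OF add smul nz vanish]
      unfolding E1_def E2_def by (simp only:)
    moreover have "F1 j j = (\<Sum>i<2*N. \<Sum>l<2*N. inverse (x k1 - x j) ^ Suc i * inverse (x k2 - x j) ^ Suc l * \<phi> j (Y ?w (int l) (Y ?u (int i) (v j))))"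
      by (simp add: F1_def \<phi>_def)
    moreover have "F2 j j = (\<Sum>i<2*N. \<Sum>l<2*N. inverse (x k1 - x j) ^ Suc i * inverse (x k2 - x j) ^ Suc l * \<phi> j (Y ?u (int i) (Y ?w (int l) (v j))))"
      unfolding F2_def \<phi>_def by (subst sum.swap) (simp add: mult_ac)
    ultimately show ?thesis by simp
  qed
  have skew: "inverse (x k1 - x k2) ^ Suc i * B vac (Y ?u (int i) ?w)
      = inverse (x k2 - x k1) ^ Suc i * B vac (Y ?w (int i) ?u)" for i
  proof -
    have "inverse (x k1 - x k2) = (-1) * inverse (x k2 - x k1)"
      using inverse_minus_eq[of "x k2 - x k1"] by simp
    then have "inverse (x k1 - x k2) ^ Suc i = - ((-1) ^ i) * inverse (x k2 - x k1) ^ Suc i"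
      by (simp only: power_mult_distrib) simp
    then show ?thesis unfolding form_vac_skew[of ?w i ?u] by simp
  qed
  have total: "(\<Sum>j\<in>set ks. E1 j) + (\<Sum>j\<in>set ks. \<Sum>j'\<in>set ks. F1 j j')
     = (\<Sum>j\<in>set ks. E2 j) + (\<Sum>j\<in>set ks. \<Sum>j'\<in>set ks. F2 j j')"
  proof -
    have "(\<Sum>j\<in>set ks. \<Sum>j'\<in>set ks. F1 j j') - (\<Sum>j\<in>set ks. \<Sum>j'\<in>set ks. F2 j j')
        = (\<Sum>j\<in>set ks. \<Sum>j'\<in>set ks. F1 j j' - F2 j' j)"
      unfolding sum_subtractf by (subst (3) sum.swap) simp
    also have "\<dots> = (\<Sum>j\<in>set ks. \<Sum>j'\<in>set ks. if j' = j then F1 j j - F2 j j else 0)"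
      using off by (intro sum.cong refl) auto
    also have "\<dots> = (\<Sum>j\<in>set ks. E2 j - E1 j)"
      using diag by (intro sum.cong refl) (simp add: algebra_simps)
    finally show ?thesis by (simp add: sum_subtractf algebra_simps)
  qed
  have d': "distinct (k2 # k1 # ks)" using d by auto
  have 1: "correlator (k1 # k2 # ks) v x =
      B vac ?u * B vac ?w * correlator ks v x
    + B vac ?u * (\<Sum>j\<in>set ks. \<Sum>l<2*N. inverse (x k2 - x j) ^ Suc l * \<phi> j (Y ?w (int l) (v j)))
    + B vac ?w * (\<Sum>j\<in>set ks. \<Sum>l<2*N. inverse (x k1 - x j) ^ Suc l * \<phi> j (Y ?u (int l) (v j)))
    + (\<Sum>i<2*N. inverse (x k1 - x k2) ^ Suc i * B vac (Y ?u (int i) ?w)) * correlator ks v x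
    + (\<Sum>j\<in>set ks. E1 j) + (\<Sum>j\<in>set ks. \<Sum>j'\<in>set ks. F1 j j')"
    unfolding \<phi>_def E1_def F1_def by (rule correlator_two[OF d]) (blast intro: N_mode N_iterate N_compose S M)+
  have 2: "correlator (k2 # k1 # ks) v x =
      B vac ?w * B vac ?u * correlator ks v x
    + B vac ?w * (\<Sum>j\<in>set ks. \<Sum>l<2*N. inverse (x k1 - x j) ^ Suc l * \<phi> j (Y ?u (int l) (v j)))
    + B vac ?u * (\<Sum>j\<in>set ks. \<Sum>l<2*N. inverse (x k2 - x j) ^ Suc l * \<phi> j (Y ?w (int l) (v j)))
    + (\<Sum>i<2*N. inverse (x k2 - x k1) ^ Suc i * B vac (Y ?w (int i) ?u)) * correlator ks v x
    + (\<Sum>j\<in>set ks. E2 j) + (\<Sum>j\<in>set ks. \<Sum>j'\<in>set ks. F2 j j')"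
    unfolding \<phi>_def E2_def F2_def by (rule correlator_two[OF d']) (blast intro: N_mode N_iterate N_compose S M)+
  show ?thesis
    unfolding 1 2 skew add.assoc total
    by (simp only: mult.commute[of "B vac ?w" "B vac ?u"] add.left_commute add.commute add.assoc)
qed

text \<open>
  The recursion on a common prefix involves the remaining indices only as a set, so the
  exchange at the head propagates to any position.
\<close>
lemma correlator_swap:
  assumes "distinct (pre @ a # b # post)" "inj_on x (set (pre @ a # b # post))"
  shows "correlator (pre @ a # b # post) v x = correlator (pre @ b # a # post) v x"
  using assms
proof (induction pre arbitrary: v)
  case Nil
  then show ?case unfolding append_Nil by (rule correlator_swap_head)
next
  case (Cons k pre)
  have IH: "correlator (pre @ a # b # post) v x = correlator (pre @ b # a # post) v x" for v
    by (rule Cons.IH, use Cons.prems(1) in simp, rule inj_on_subset[OF Cons.prems(2)]) auto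
  have "set (pre @ a # b # post) = set (pre @ b # a # post)" by auto
  then show ?case by (simp only: append_Cons correlator.simps IH)
qed

lemma correlator_move:
  assumes "distinct (pre @ a # post)" "inj_on x (set (pre @ a # post))"
  shows "correlator (pre @ a # post) v x = correlator (pre @ post @ [a]) v x"
  using assms
proof (induction post arbitrary: pre)
  case (Cons b post)
  have "correlator (pre @ a # b # post) v x = correlator ((pre @ [b]) @ a # post) v x"
    using correlator_swap[OF Cons.prems] by simp
  also have "\<dots> = correlator ((pre @ [b]) @ post @ [a]) v x"
    by (rule Cons.IH, use Cons.prems(1) in fastforce, rule inj_on_subset[OF Cons.prems(2)]) auto
  finally show ?case by simp
qed simp

lemma correlator_rev:
  assumes "distinct ks" "inj_on x (set ks)"
  shows "correlator (rev ks) v x = correlator ks v x"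
proof -
  have "correlator (pre @ rev ks) v x = correlator (pre @ ks) v x"
    if "distinct (pre @ ks)" "inj_on x (set (pre @ ks))" for pre
    using that
  proof (induction ks arbitrary: pre)
    case (Cons a ks)
    have "correlator ((pre @ [a]) @ ks) v x = correlator ((pre @ [a]) @ rev ks) v x"
      by (rule Cons.IH[symmetric], use Cons.prems(1) in simp, rule inj_on_subset[OF Cons.prems(2)]) auto
    also have "\<dots> = correlator (pre @ rev ks @ [a]) v x"
    proof -
      have "distinct (pre @ a # rev ks)" using Cons.prems(1) by auto
      moreover have "inj_on x (set (pre @ a # rev ks))" using Cons.prems(2) by simp
      ultimately show ?thesis using correlator_move[of pre a "rev ks" x v] by simp
    qed
    finally show ?case by simp
  qed simp
  from this[of "[]"] show ?thesis using assms by simp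
qed

end

section \<open>Rationality and uniqueness of the rational continuation\<close>

text \<open>
  Admits any finite family of monomials, possibly with repetitions; equal exponents are
  collected afterwards.
\<close>
lemma polynomial_funI:
  fixes e :: "'i \<Rightarrow> nat \<Rightarrow> nat"
  assumes "finite I" "\<And>y. P y = (\<Sum>i\<in>I. c i * (\<Prod>k=1..n. y k ^ e i k))"
  shows "polynomial_fun n P"
proof -
  have "P y = (\<Sum>\<alpha>\<in>e ` I. (\<Sum>i\<in>{i\<in>I. e i = \<alpha>}. c i) * (\<Prod>k=1..n. y k ^ \<alpha> k))" for y
    unfolding assms(2) sum_distrib_right
    by (subst sum.image_gen[OF assms(1), of _ e], intro sum.cong refl) auto
  then have "P = (\<lambda>y. \<Sum>\<alpha>\<in>e ` I. (\<Sum>i\<in>{i\<in>I. e i = \<alpha>}. c i) * (\<Prod>k=1..n. y k ^ \<alpha> k))" by (rule ext)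
  moreover have "finite (e ` I)" using assms(1) by simp
  ultimately show ?thesis unfolding polynomial_fun_def
    by (intro exI[of _ "e ` I"] exI[of _ "\<lambda>\<alpha>. \<Sum>i\<in>{i\<in>I. e i = \<alpha>}. c i"] conjI)
qed

lemma polynomial_fun_const: "polynomial_fun n (\<lambda>y. c)"
  by (rule polynomial_funI[of "{()}" _ "\<lambda>_. c" "\<lambda>_ _. 0" n]) simp_all

lemma polynomial_fun_coord:
  assumes "k \<in> {1..n}"
  shows "polynomial_fun n (\<lambda>y. y k)"
proof (rule polynomial_funI[of "{()}" _ "\<lambda>_. 1" "\<lambda>_ j. if j = k then 1 else 0" n])
  fix y :: "nat \<Rightarrow> complex"
  have "(\<Prod>j=1..n. y j ^ (if j = k then 1 else 0)) = (\<Prod>j\<in>{1..n}. if j = k then y j else 1)"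
    by (rule prod.cong) auto
  also have "\<dots> = y k" using assms by simp
  finally have "(\<Prod>j=1..n. y j ^ (if j = k then 1 else 0)) = y k" .
  then show "y k = (\<Sum>i\<in>{()}. 1 * (\<Prod>j=1..n. y j ^ (if j = k then 1 else 0)))"
    by (simp only: sum.insert finite.emptyI empty_iff not_False_eq_True sum.empty mult_1 add_0_right)
qed simp

lemma polynomial_fun_add:
  assumes "polynomial_fun n P" "polynomial_fun n Q"
  shows "polynomial_fun n (\<lambda>y. P y + Q y)"
proof -
  obtain A c A' c' where A: "finite A" "P = (\<lambda>y. \<Sum>\<alpha>\<in>A. c \<alpha> * (\<Prod>k=1..n. y k ^ \<alpha> k))"
    and A': "finite A'" "Q = (\<lambda>y. \<Sum>\<alpha>\<in>A'. c' \<alpha> * (\<Prod>k=1..n. y k ^ \<alpha> k))"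
    using assms unfolding polynomial_fun_def by blast
  show ?thesis
    by (rule polynomial_funI[of "A <+> A'" _ "case_sum c c'" "case_sum id id" n])
       (use A A' in \<open>simp_all add: sum.Plus\<close>)
qed

lemma polynomial_fun_mult:
  assumes "polynomial_fun n P" "polynomial_fun n Q"
  shows "polynomial_fun n (\<lambda>y. P y * Q y)"
proof -
  obtain A c A' c' where A: "finite A" "P = (\<lambda>y. \<Sum>\<alpha>\<in>A. c \<alpha> * (\<Prod>k=1..n. y k ^ \<alpha> k))"
    and A': "finite A'" "Q = (\<lambda>y. \<Sum>\<alpha>\<in>A'. c' \<alpha> * (\<Prod>k=1..n. y k ^ \<alpha> k))"
    using assms unfolding polynomial_fun_def by blast
  show ?thesis
    by (rule polynomial_funI[of "A \<times> A'" _ "\<lambda>(\<alpha>, \<beta>). c \<alpha> * c' \<beta>" "\<lambda>(\<alpha>, \<beta>) k. \<alpha> k + \<beta> k" n])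
      (use A(1) A'(1) in simp, unfold A(2) A'(2) sum_product sum.cartesian_product,
        rule sum.cong[OF refl], auto simp: power_add prod.distrib)
qed

lemma polynomial_fun_diff:
  assumes "polynomial_fun n P" "polynomial_fun n Q"
  shows "polynomial_fun n (\<lambda>y. P y - Q y)"
  using polynomial_fun_add[OF assms(1) polynomial_fun_mult[OF polynomial_fun_const[of n "-1"] assms(2)]]
  by simp

lemma polynomial_fun_line:
  assumes "polynomial_fun n P"
  shows "\<exists>p. \<forall>t. P (\<lambda>k. x k + t * z k) = poly p t"
proof -
  obtain A c where "P = (\<lambda>y. \<Sum>\<alpha>\<in>A. c \<alpha> * (\<Prod>k=1..n. y k ^ \<alpha> k))"
    using assms unfolding polynomial_fun_def by blast
  then have "P (\<lambda>k. x k + t * z k) = poly (\<Sum>\<alpha>\<in>A. smult (c \<alpha>) (\<Prod>k=1..n. [:x k, z k:] ^ \<alpha> k)) t" for t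
    by (simp add: poly_sum poly_prod)
  then show ?thesis by blast
qed

definition nonzero_points :: "nat \<Rightarrow> (nat \<Rightarrow> complex) set" where
  "nonzero_points n = {x. \<forall>k\<in>{1..n}. x k \<noteq> 0}"

text \<open>
  Restrict the polynomial to the line from a point in the interior of the radially ordered
  region to \<open>y\<close>: the polynomial in one variable so obtained vanishes near \<open>0\<close>, hence
  everywhere.
\<close>
lemma polynomial_fun_identity:
  assumes P: "polynomial_fun n P"
    and zero: "\<And>x. x \<in> radially_ordered n \<inter> nonzero_points n \<Longrightarrow> P x = 0"
  shows "P y = 0"
proof -
  \<comment> \<open>Radially ordered with strict inequalities and nonzero entries, hence an interior point.\<close>
  define x where "x k = (of_nat (Suc n - k) :: complex)" for k
  define z where "z k = y k - x k" for k
  obtain p where p: "\<And>t. P (\<lambda>k. x k + t * z k) = poly p t"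
    using polynomial_fun_line[OF P] by blast
  have lim: "((\<lambda>t. norm (x k + t * z k)) \<longlongrightarrow> norm (x k)) (at 0)" for k
    by (auto intro!: tendsto_eq_intros)
  have "\<forall>\<^sub>F t in at 0. norm (x k + t * z k) > 0" if "k \<in> {1..n}" for k
    by (rule order_tendstoD(1)[OF lim]) (use that in \<open>auto simp: x_def simp del: of_nat_Suc\<close>)
  then have "\<forall>\<^sub>F t in at 0. \<forall>k\<in>{1..n}. norm (x k + t * z k) > 0"
    by (intro eventually_ball_finite) auto
  moreover have "\<forall>\<^sub>F t in at 0. norm (x i + t * z i) - norm (x j + t * z j) > 0"
    if "i \<in> {1..n}" "j \<in> {1..n}" "i < j" for i j
    by (rule order_tendstoD(1)[OF tendsto_diff[OF lim lim]])
       (use that in \<open>simp only: x_def norm_of_nat, simp\<close>)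
  then have "\<forall>\<^sub>F t in at 0. \<forall>i\<in>{1..n}. \<forall>j\<in>{1..n}. i < j \<longrightarrow> norm (x i + t * z i) - norm (x j + t * z j) > 0"
    by (intro eventually_ball_finite ballI) (auto intro: eventually_mono)
  ultimately have "\<forall>\<^sub>F t in at 0. poly p t = 0"
  proof eventually_elim
    case (elim t)
    then have "(\<lambda>k. x k + t * z k) \<in> radially_ordered n \<inter> nonzero_points n"
      by (auto simp: radially_ordered_def nonzero_points_def)
    then show ?case using zero p by metis
  qed
  moreover have "\<forall>\<^sub>F t in at 0. poly p t \<noteq> 0" if "p \<noteq> 0"
    using islimpt_finite[OF poly_roots_finite[OF that], of 0]
    by (simp add: islimpt_iff_eventually)
  ultimately have "p = 0"
  proof -
    assume *: "\<forall>\<^sub>F t in at 0. poly p t = 0" "p \<noteq> 0 \<Longrightarrow> \<forall>\<^sub>F t in at 0. poly p t \<noteq> 0"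
    show ?thesis
    proof (rule ccontr)
      assume "p \<noteq> 0"
      from eventually_conj[OF *(1) *(2)[OF this]] show False by simp
    qed
  qed
  then show ?thesis using p[of 1] by (simp add: z_def)
qed

text \<open>
  The denominator has no zero on \<open>D\<close>, so that two such functions can be compared at each
  point of \<open>D\<close> and not only generically.
\<close>
definition rational_on :: "nat \<Rightarrow> (nat \<Rightarrow> complex) set \<Rightarrow> ((nat \<Rightarrow> complex) \<Rightarrow> complex) \<Rightarrow> bool" where
  "rational_on n D f \<longleftrightarrow> (\<exists>P Q. polynomial_fun n P \<and> polynomial_fun n Q
     \<and> (\<forall>x\<in>D. Q x \<noteq> 0 \<and> f x = P x / Q x))"

lemma rational_onI:
  "polynomial_fun n P \<Longrightarrow> polynomial_fun n Q \<Longrightarrow> (\<And>x. x \<in> D \<Longrightarrow> Q x \<noteq> 0 \<and> f x = P x / Q x)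
    \<Longrightarrow> rational_on n D f"
  unfolding rational_on_def by blast

lemma rational_on_cong: "rational_on n D f \<Longrightarrow> (\<And>x. x \<in> D \<Longrightarrow> f x = g x) \<Longrightarrow> rational_on n D g"
  unfolding rational_on_def by auto

lemma rational_on_subset:
  assumes "rational_on n D f" "D' \<subseteq> D"
  shows "rational_on n D' f"
proof -
  obtain P Q where "polynomial_fun n P" "polynomial_fun n Q" "\<forall>x\<in>D. Q x \<noteq> 0 \<and> f x = P x / Q x"
    using assms(1) unfolding rational_on_def by blast
  then show ?thesis
    by (intro rational_onI[of n P Q]) (use assms(2) in \<open>simp_all add: subset_iff\<close>)
qed

lemma rational_on_const: "rational_on n D (\<lambda>x. c)"
  by (rule rational_onI[OF polynomial_fun_const[of n c] polynomial_fun_const[of n 1]]) auto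

lemma rational_on_add:
  assumes "rational_on n D f" "rational_on n D g"
  shows "rational_on n D (\<lambda>x. f x + g x)"
proof -
  obtain P Q P' Q' where *: "polynomial_fun n P" "polynomial_fun n Q" "\<forall>x\<in>D. Q x \<noteq> 0 \<and> f x = P x / Q x"
      "polynomial_fun n P'" "polynomial_fun n Q'" "\<forall>x\<in>D. Q' x \<noteq> 0 \<and> g x = P' x / Q' x"
    using assms unfolding rational_on_def by blast
  show ?thesis
    by (rule rational_onI[of n "\<lambda>x. P x * Q' x + P' x * Q x" "\<lambda>x. Q x * Q' x"])
       (use * in \<open>auto intro!: polynomial_fun_add polynomial_fun_mult simp: add_frac_eq\<close>)
qed

lemma rational_on_mult:
  assumes "rational_on n D f" "rational_on n D g"
  shows "rational_on n D (\<lambda>x. f x * g x)"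
proof -
  obtain P Q P' Q' where *: "polynomial_fun n P" "polynomial_fun n Q" "\<forall>x\<in>D. Q x \<noteq> 0 \<and> f x = P x / Q x"
      "polynomial_fun n P'" "polynomial_fun n Q'" "\<forall>x\<in>D. Q' x \<noteq> 0 \<and> g x = P' x / Q' x"
    using assms unfolding rational_on_def by blast
  show ?thesis
    by (rule rational_onI[of n "\<lambda>x. P x * P' x" "\<lambda>x. Q x * Q' x"])
       (use * in \<open>auto intro!: polynomial_fun_mult\<close>)
qed

lemma rational_on_sum:
  "(\<And>i. i \<in> I \<Longrightarrow> rational_on n D (f i)) \<Longrightarrow> rational_on n D (\<lambda>x. \<Sum>i\<in>I. f i x)"
  by (induction I rule: infinite_finite_induct) (auto intro: rational_on_const rational_on_add)

lemma rational_on_power: "rational_on n D f \<Longrightarrow> rational_on n D (\<lambda>x. f x ^ m)"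
  by (induction m) (auto intro: rational_on_const rational_on_mult)

lemma rational_on_unique:
  assumes "rational_on n D f" "rational_on n D g" "radially_ordered n \<inter> nonzero_points n \<subseteq> D"
    and eq: "\<And>x. x \<in> radially_ordered n \<inter> nonzero_points n \<Longrightarrow> f x = g x" and y: "y \<in> D"
  shows "f y = g y"
proof -
  obtain P Q P' Q' where *: "polynomial_fun n P" "polynomial_fun n Q" "\<forall>x\<in>D. Q x \<noteq> 0 \<and> f x = P x / Q x"
      "polynomial_fun n P'" "polynomial_fun n Q'" "\<forall>x\<in>D. Q' x \<noteq> 0 \<and> g x = P' x / Q' x"
    using assms unfolding rational_on_def by blast
  have "P y * Q' y - P' y * Q y = 0"
  proof (rule polynomial_fun_identity[where P = "\<lambda>y. P y * Q' y - P' y * Q y"])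
    show "polynomial_fun n (\<lambda>y. P y * Q' y - P' y * Q y)"
      using * by (intro polynomial_fun_diff polynomial_fun_mult)
    fix x assume x: "x \<in> radially_ordered n \<inter> nonzero_points n"
    then have "x \<in> D" using assms(3) by blast
    then show "P x * Q' x - P' x * Q x = 0"
      using eq[OF x] *(3,6) by (simp add: frac_eq_eq)
  qed
  then show ?thesis using *(3,6) y by (simp add: frac_eq_eq)
qed

context cft_voa
begin

text \<open>
  Vectors depending rationally on the points, with values in a finite-dimensional subspace.
  The inversion needs these, as it transforms the vectors by factors that depend on the points.
\<close>
definition rational_vec :: "nat \<Rightarrow> (nat \<Rightarrow> complex) set \<Rightarrow> ((nat \<Rightarrow> complex) \<Rightarrow> 'v) \<Rightarrow> bool" where
  "rational_vec n D W \<longleftrightarrow> (\<exists>A r. finite A \<and> (\<forall>w\<in>A. rational_on n D (r w))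
     \<and> (\<forall>x\<in>D. W x = (\<Sum>w\<in>A. smul (r w x) w)))"

lemma rational_vecI:
  fixes w :: "'i \<Rightarrow> 'v"
  assumes "finite I" "\<And>i. i \<in> I \<Longrightarrow> rational_on n D (r i)"
    "\<And>x. x \<in> D \<Longrightarrow> W x = (\<Sum>i\<in>I. smul (r i x) (w i))"
  shows "rational_vec n D W"
proof -
  have "W x = (\<Sum>a\<in>w ` I. smul (\<Sum>i\<in>{i\<in>I. w i = a}. r i x) a)" if "x \<in> D" for x
    unfolding assms(3)[OF that] scale_sum_left
    by (subst sum.image_gen[OF assms(1), of _ w], intro sum.cong refl) auto
  moreover have "rational_on n D (\<lambda>x. \<Sum>i\<in>{i\<in>I. w i = a}. r i x)" for a
    by (rule rational_on_sum) (use assms(2) in auto)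
  moreover have "finite (w ` I)" using assms(1) by simp
  ultimately show ?thesis unfolding rational_vec_def
    by (intro exI[of _ "w ` I"] exI[of _ "\<lambda>a x. \<Sum>i\<in>{i\<in>I. w i = a}. r i x"]) blast
qed

lemma rational_vec_const: "rational_vec n D (\<lambda>x. w)"
  by (rule rational_vecI[of "{()}" n D "\<lambda>_ _. 1" _ "\<lambda>_. w"]) (auto intro: rational_on_const)

lemma rational_vec_mode:
  assumes "rational_vec n D W" "rational_vec n D W'"
  shows "rational_vec n D (\<lambda>x. Y (W x) m (W' x))"
proof -
  obtain A r A' r' where *: "finite A" "\<forall>w\<in>A. rational_on n D (r w)" "\<forall>x\<in>D. W x = (\<Sum>w\<in>A. smul (r w x) w)"
    "finite A'" "\<forall>w\<in>A'. rational_on n D (r' w)" "\<forall>x\<in>D. W' x = (\<Sum>w\<in>A'. smul (r' w x) w)"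
    using assms unfolding rational_vec_def by blast
  show ?thesis
  proof (rule rational_vecI[of "A \<times> A'" n D "\<lambda>(a, a') x. r a x * r' a' x" _ "\<lambda>(a, a'). Y a m a'"])
    show "finite (A \<times> A')" using * by simp
    show "rational_on n D (case p of (a, a') \<Rightarrow> \<lambda>x. r a x * r' a' x)" if "p \<in> A \<times> A'" for p
      using that * by (auto intro: rational_on_mult)
    show "Y (W x) m (W' x) = (\<Sum>p\<in>A \<times> A'. smul ((case p of (a, a') \<Rightarrow> \<lambda>x. r a x * r' a' x) x) (case p of (a, a') \<Rightarrow> Y a m a'))"
      if "x \<in> D" for x
    proof -
      have "Y (W x) m (W' x) = (\<Sum>a\<in>A. \<Sum>a'\<in>A'. smul (r a x * r' a' x) (Y a m a'))"
        using * that by (simp add: mode_sum_left mode_sum_right mode_linear_left mode_linear_right scale_sum_right)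
          (subst sum.swap, simp add: mult.commute)
      then show ?thesis by (simp add: sum.cartesian_product case_prod_unfold)
    qed
  qed
qed

lemma rational_vec_form:
  assumes "rational_vec n D W"
  shows "rational_on n D (\<lambda>x. B u (W x))"
proof -
  obtain A r where *: "finite A" "\<forall>w\<in>A. rational_on n D (r w)" "\<forall>x\<in>D. W x = (\<Sum>w\<in>A. smul (r w x) w)"
    using assms unfolding rational_vec_def by blast
  have "rational_on n D (\<lambda>x. \<Sum>w\<in>A. r w x * B u w)"
    using * by (intro rational_on_sum rational_on_mult rational_on_const) auto
  then show ?thesis
    by (rule rational_on_cong) (use * in \<open>simp add: form_sum_right form_linear_right\<close>)
qed

lemma rational_vec_truncation:
  assumes "rational_vec n D W" "rational_vec n D W'"
  shows "\<exists>N::nat. \<forall>x\<in>D. \<forall>i\<ge>N. Y (W x) (int i) (W' x) = 0"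
proof -
  obtain A r A' r' where *: "finite A" "\<forall>x\<in>D. W x = (\<Sum>w\<in>A. smul (r w x) w)"
    "finite A'" "\<forall>x\<in>D. W' x = (\<Sum>w\<in>A'. smul (r' w x) w)"
    using assms unfolding rational_vec_def by blast
  obtain N where "\<forall>u\<in>A. \<forall>w\<in>A'. \<forall>i\<ge>N. Y u (int i) w = 0"
    using truncation_uniform[OF *(1,3)] by blast
  then have "\<forall>x\<in>D. \<forall>i\<ge>N. Y (W x) (int i) (W' x) = 0"
    using * by (simp add: mode_sum_left mode_sum_right mode_linear_left mode_linear_right)
  then show ?thesis by blast
qed

text \<open>
  The recursion is built from finitely many ring operations, the inverses of differences of points and the
  bilinear modes. A truncation bound valid on all of \<open>D\<close> exists because the
  vectors stay in a finite-dimensional space.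
\<close>
lemma correlator_rational:
  assumes "\<And>k. k \<in> set ks \<Longrightarrow> rational_vec n D (\<lambda>x. W x k)" "distinct ks"
    and "\<And>i j. i \<in> set ks \<Longrightarrow> j \<in> set ks \<Longrightarrow> i \<noteq> j \<Longrightarrow> rational_on n D (\<lambda>x. inverse (p x i - p x j))"
  shows "rational_on n D (\<lambda>x. correlator ks (W x) (p x))"
  using assms
proof (induction ks arbitrary: W)
  case Nil
  then show ?case by (simp add: rational_on_const)
next
  case (Cons k ks)
  have W: "rational_vec n D (\<lambda>x. W x j)" if "j \<in> set (k # ks)" for j
    using Cons.prems that by blast
  have "\<forall>j\<in>set ks. \<exists>N::nat. \<forall>x\<in>D. \<forall>i\<ge>N. Y (W x k) (int i) (W x j) = 0"
    by (intro ballI rational_vec_truncation[OF W W]) simp_all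
  then obtain N :: "nat \<Rightarrow> nat" where N: "\<And>j x i. j \<in> set ks \<Longrightarrow> x \<in> D \<Longrightarrow> i \<ge> N j \<Longrightarrow> Y (W x k) (int i) (W x j) = 0"
    by metis
  define M where "M = Max (insert 0 (N ` set ks))"
  have M: "N j \<le> M" if "j \<in> set ks" for j
    unfolding M_def using that by (intro Max_ge) auto
  have IH: "rational_on n D (\<lambda>x. correlator ks (W' x) (p x))"
    if "\<And>j. j \<in> set ks \<Longrightarrow> rational_vec n D (\<lambda>x. W' x j)" for W'
    by (rule Cons.IH) (use Cons.prems that in auto)
  have upd: "rational_vec n D (\<lambda>x. ((W x)(j := Y (W x k) (int i) (W x j))) l)"
    if "j \<in> set ks" "l \<in> set ks" for i j l
    using that W by (cases "l = j") (auto intro: rational_vec_mode)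
  have "rational_on n D (\<lambda>x. B vac (W x k) * correlator ks (W x) (p x)
     + (\<Sum>j\<in>set ks. \<Sum>i<M. inverse (p x k - p x j) ^ Suc i
          * correlator ks ((W x)(j := Y (W x k) (int i) (W x j))) (p x)))"
    by (intro rational_on_add rational_on_mult rational_on_sum rational_on_power rational_vec_form W IH upd Cons.prems(3))
       (use Cons.prems(2) in auto)
  then show ?case
  proof (rule rational_on_cong)
    fix x assume "x \<in> D"
    then show "B vac (W x k) * correlator ks (W x) (p x)
     + (\<Sum>j\<in>set ks. \<Sum>i<M. inverse (p x k - p x j) ^ Suc i
          * correlator ks ((W x)(j := Y (W x k) (int i) (W x j))) (p x)) = correlator (k # ks) (W x) (p x)"
      by (intro correlator_Cons[symmetric]) (meson M N order_trans)
  qed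
qed

lemma correlator_rational_points:
  "rational_on n {x. inj_on x {1..n}} (correlator [1..<Suc n] v)"
proof (rule correlator_rational)
  fix i j assume "i \<in> set [1..<Suc n]" "j \<in> set [1..<Suc n]" "i \<noteq> j"
  then have ij: "i \<in> {1..n}" "j \<in> {1..n}" "i \<noteq> j" by auto
  show "rational_on n {x. inj_on x {1..n}} (\<lambda>x. inverse (x i - x j))"
    by (rule rational_onI[of n "\<lambda>_. 1" "\<lambda>x. x i - x j"])
       (use ij in \<open>auto intro!: polynomial_fun_const polynomial_fun_diff polynomial_fun_coord
          simp: inverse_eq_divide dest: inj_onD\<close>)
qed (auto intro: rational_vec_const)

lemma radially_ordered_inj: "x \<in> radially_ordered n \<Longrightarrow> inj_on x {1..n}"
  unfolding radially_ordered_def inj_on_def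
  by (metis (mono_tags, lifting) linorder_neqE_nat mem_Collect_eq order_less_irrefl)

lemma npoint_term_has_sum:
  assumes "x \<in> radially_ordered n"
  shows "(npoint_term Y vac B n v x has_sum correlator [1..<Suc n] v x) ({1..n} \<rightarrow>\<^sub>E UNIV)"
proof -
  have set: "set [1..<Suc n] = {1..n}" by auto
  have "npoint_term Y vac B n v x = mode_term [1..<Suc n] v x"
    unfolding npoint_term_def mode_term_def apply_modes_def set by blast
  moreover have "sorted_wrt (\<lambda>i j. norm (x i) > norm (x j)) [1..<Suc n]"
    using assms by (auto simp: radially_ordered_def sorted_wrt_iff_nth_less simp del: upt_Suc)
  ultimately show ?thesis
    using correlator_has_sum[of "[1..<Suc n]" x v] unfolding set by simp
qed

text \<open>
  Any two representations of the sum as a quotient of polynomials agree wherever both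
  denominators are nonzero, so the definite description is determined by the representation that
  \<open>correlator_rational_points\<close> provides.
\<close>
theorem Z0_eq_correlator:
  assumes y: "inj_on y {1..n}"
  shows "Z0 Y vac B n v y = correlator [1..<Suc n] v y"
proof -
  obtain P Q where P: "polynomial_fun n P" and Q: "polynomial_fun n Q"
    and PQ: "\<And>x. inj_on x {1..n} \<Longrightarrow> Q x \<noteq> 0 \<and> correlator [1..<Suc n] v x = P x / Q x"
    using correlator_rational_points[of n v] unfolding rational_on_def by auto
  show ?thesis unfolding Z0_def
  proof (rule the_equality)
    show "\<exists>P Q. polynomial_fun n P \<and> polynomial_fun n Q \<and> Q y \<noteq> 0 \<and> correlator [1..<Suc n] v y = P y / Q y \<and>
        (\<forall>x \<in> radially_ordered n. Q x \<noteq> 0 \<longrightarrow>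
          (npoint_term Y vac B n v x has_sum P x / Q x) ({1..n} \<rightarrow>\<^sub>E UNIV))"
      using P Q PQ[OF y] PQ[OF radially_ordered_inj] npoint_term_has_sum[of _ n v]
      by (intro exI[of _ P] exI[of _ Q]) (metis (no_types, lifting))
  next
    fix z
    assume "\<exists>P Q. polynomial_fun n P \<and> polynomial_fun n Q \<and> Q y \<noteq> 0 \<and> z = P y / Q y \<and>
        (\<forall>x \<in> radially_ordered n. Q x \<noteq> 0 \<longrightarrow>
          (npoint_term Y vac B n v x has_sum P x / Q x) ({1..n} \<rightarrow>\<^sub>E UNIV))"
    then obtain P' Q' where P': "polynomial_fun n P'" and Q': "polynomial_fun n Q'" and y': "Q' y \<noteq> 0" "z = P' y / Q' y"
      and sum': "\<And>x. x \<in> radially_ordered n \<Longrightarrow> Q' x \<noteq> 0 \<Longrightarrow>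
          (npoint_term Y vac B n v x has_sum P' x / Q' x) ({1..n} \<rightarrow>\<^sub>E UNIV)"
      by blast
    \<comment> \<open>The sum is known to be \<open>P'/Q'\<close> only where \<open>Q'\<close> is nonzero; the additional factor covers the other points.\<close>
    have "(P y * Q' y - P' y * Q y) * Q' y = 0"
    proof (rule polynomial_fun_identity[where P = "\<lambda>y. (P y * Q' y - P' y * Q y) * Q' y"])
      show "polynomial_fun n (\<lambda>y. (P y * Q' y - P' y * Q y) * Q' y)"
        using P Q P' Q' by (intro polynomial_fun_diff polynomial_fun_mult)
      fix x assume "x \<in> radially_ordered n \<inter> nonzero_points n"
      then have x: "x \<in> radially_ordered n" by simp
      show "(P x * Q' x - P' x * Q x) * Q' x = 0"
      proof (cases "Q' x = 0")
        case False
        have "P x / Q x = P' x / Q' x"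
          using has_sum_unique[OF npoint_term_has_sum[OF x] sum'[OF x False]] PQ[OF radially_ordered_inj[OF x]] by simp
        then show ?thesis using False PQ[OF radially_ordered_inj[OF x]] by (simp add: frac_eq_eq)
      qed simp
    qed
    then show "z = correlator [1..<Suc n] v y"
      using y' PQ[OF y] by (simp add: frac_eq_eq)
  qed
qed

end

section \<open>Moebius covariance\<close>

lemma sum_PiE_insert:
  assumes "k \<notin> S"
  shows "(\<Sum>g\<in>PiE (insert k S) (\<lambda>_. J). F g) = (\<Sum>g\<in>PiE S (\<lambda>_. J). \<Sum>j\<in>J. F (g(k := j)))"
proof -
  have "(\<Sum>g\<in>PiE (insert k S) (\<lambda>_. J). F g) = (\<Sum>(j, g)\<in>J \<times> PiE S (\<lambda>_. J). F (g(k := j)))"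
    unfolding PiE_insert_eq using inj_combinator[OF assms, of "\<lambda>_. J"]
    by (subst sum.reindex) (simp_all add: case_prod_unfold)
  then show ?thesis
    unfolding sum.cartesian_product[symmetric] by (subst sum.swap)
qed

lemma prod_power_int:
  fixes r :: "'a::field"
  assumes "r \<noteq> 0"
  shows "(\<Prod>k\<in>S. r powi (f k)) = r powi (\<Sum>k\<in>S. f k)"
  by (induction S rule: infinite_finite_induct) (simp_all add: power_int_add assms)

context cft_voa
begin

text \<open>
  Multilinearity. It reduces fields with coefficients that depend on the points, such as
  \<open>e\<^bsup>yL(1)\<^esup> y\<^bsup>-2L(0)\<^esup> v\<close>, to fixed vectors \<open>L(1)\<^sup>j v\<close>, for which the mode expansion is available.
\<close>
lemma correlator_expand:
  assumes "distinct ks"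
  shows "correlator ks (\<lambda>k. \<Sum>j<J. smul (r k j) (w k j)) x
    = (\<Sum>g\<in>PiE (set ks) (\<lambda>_. {..<J}). (\<Prod>k\<in>set ks. r k (g k)) * correlator ks (\<lambda>k. w k (g k)) x)"
proof -
  have "correlator ks (\<lambda>k. if k \<in> T then \<Sum>j<J. smul (r k j) (w k j) else v k) x
    = (\<Sum>g\<in>PiE T (\<lambda>_. {..<J}). (\<Prod>k\<in>T. r k (g k)) * correlator ks (\<lambda>k. if k \<in> T then w k (g k) else v k) x)"
    if "finite T" "T \<subseteq> set ks" for T v
    using that
  proof (induction T arbitrary: v rule: finite_induct)
    case empty
    then show ?case by simp
  next
    case (insert p T)
    have p: "p \<in> set ks" using insert by auto
    let ?X = "\<Sum>j<J. smul (r p j) (w p j)"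
    have "correlator ks (\<lambda>k. if k \<in> insert p T then \<Sum>j<J. smul (r k j) (w k j) else v k) x
       = correlator ks (\<lambda>k. if k \<in> T then \<Sum>j<J. smul (r k j) (w k j) else (v(p := ?X)) k) x"
      by (rule correlator_cong) (use insert.hyps in auto)
    also have "\<dots> = (\<Sum>g\<in>PiE T (\<lambda>_. {..<J}). (\<Prod>k\<in>T. r k (g k))
        * correlator ks (\<lambda>k. if k \<in> T then w k (g k) else (v(p := ?X)) k) x)"
      by (rule insert.IH) (use insert.prems in auto)
    also have "\<dots> = (\<Sum>g\<in>PiE T (\<lambda>_. {..<J}). (\<Prod>k\<in>T. r k (g k))
        * (\<Sum>j<J. r p j * correlator ks ((\<lambda>k. if k \<in> T then w k (g k) else v k)(p := w p j)) x))"
    proof (rule sum.cong[OF refl])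
      fix g
      have "correlator ks (\<lambda>k. if k \<in> T then w k (g k) else (v(p := ?X)) k) x
         = correlator ks ((\<lambda>k. if k \<in> T then w k (g k) else v k)(p := ?X)) x"
        by (rule correlator_cong) (use insert.hyps in auto)
      also have "\<dots> = (\<Sum>j<J. r p j * correlator ks ((\<lambda>k. if k \<in> T then w k (g k) else v k)(p := w p j)) x)"
        by (rule correlator_sum[OF p assms])
      finally show "(\<Prod>k\<in>T. r k (g k)) * correlator ks (\<lambda>k. if k \<in> T then w k (g k) else (v(p := ?X)) k) x
         = (\<Prod>k\<in>T. r k (g k)) * (\<Sum>j<J. r p j * correlator ks ((\<lambda>k. if k \<in> T then w k (g k) else v k)(p := w p j)) x)"
        by (rule arg_cong)
    qed
    also have "\<dots> = (\<Sum>g\<in>PiE T (\<lambda>_. {..<J}). \<Sum>j<J. (\<Prod>k\<in>insert p T. r k ((g(p := j)) k))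
        * correlator ks (\<lambda>k. if k \<in> insert p T then w k ((g(p := j)) k) else v k) x)"
    proof (intro sum.cong refl, unfold sum_distrib_left, intro sum.cong refl)
      fix g j
      have "correlator ks ((\<lambda>k. if k \<in> T then w k (g k) else v k)(p := w p j)) x
          = correlator ks (\<lambda>k. if k \<in> insert p T then w k ((g(p := j)) k) else v k) x"
        by (rule correlator_cong) auto
      moreover have "(\<Prod>k\<in>insert p T. r k ((g(p := j)) k)) = r p j * (\<Prod>k\<in>T. r k (g k))"
      proof -
        have "(\<Prod>k\<in>T. r k ((g(p := j)) k)) = (\<Prod>k\<in>T. r k (g k))"
          by (rule prod.cong) (use insert.hyps in auto)
        then show ?thesis unfolding prod.insert[OF insert.hyps] by simp
      qed
      ultimately show "(\<Prod>k\<in>T. r k (g k)) * (r p j * correlator ks ((\<lambda>k. if k \<in> T then w k (g k) else v k)(p := w p j)) x)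
         = (\<Prod>k\<in>insert p T. r k ((g(p := j)) k)) * correlator ks (\<lambda>k. if k \<in> insert p T then w k ((g(p := j)) k) else v k) x"
        by (simp only: mult_ac)
    qed
    finally show ?case unfolding sum_PiE_insert[OF insert.hyps(2)] .
  qed
  from this[of "set ks" "\<lambda>_. 0"]
  have "correlator ks (\<lambda>k. if k \<in> set ks then \<Sum>j<J. smul (r k j) (w k j) else 0) x
    = (\<Sum>g\<in>PiE (set ks) (\<lambda>_. {..<J}). (\<Prod>k\<in>set ks. r k (g k))
        * correlator ks (\<lambda>k. if k \<in> set ks then w k (g k) else 0) x)"
    by simp
  moreover have "correlator ks (\<lambda>k. if k \<in> set ks then u k else 0) x = correlator ks u x" for u
    by (rule correlator_cong) auto
  ultimately show ?thesis by (simp only:)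
qed

lemma correlator_smul_all:
  assumes "distinct ks"
  shows "correlator ks (\<lambda>k. smul (r k) (v k)) x = (\<Prod>k\<in>set ks. r k) * correlator ks v x"
  using correlator_expand[OF assms, where J = "1::nat" and r = "\<lambda>k j. r k" and w = "\<lambda>k j. v k" and x = x]
  by (simp add: card_PiE lessThan_Suc)

lemma exp_L1_eq_sum:
  assumes "v \<in> V q" "q < int J"
  shows "exp_L1 smul Y \<omega> z (smul s v) = (\<Sum>j<J. smul (z ^ j / fact j * s) ((L 1 ^^ j) v))"
proof -
  have "(L 1 ^^ j) v = 0" if "j \<ge> J" for j
    using L1_pow_eq_zero[OF assms(1), of j] assms(2) that by simp
  then have "exp_L1 smul Y \<omega> z (smul s v) = (\<Sum>j<J. smul (z ^ j / fact j) ((L 1 ^^ j) (smul s v)))"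
    unfolding exp_L1_def by (intro Sum_any_eq_lessThan) (simp add: L1_pow_smul)
  then show ?thesis by (simp add: L1_pow_smul)
qed

lemma opp_mode_eq_sum:
  assumes "v \<in> V q" "q < int J"
  shows "opp_mode smul Y \<omega> q v m w
    = (\<Sum>j<J. smul ((-1) powi q / fact j) (Y ((L 1 ^^ j) v) (2 * q - m - int j - 2) w))"
proof -
  have "(L 1 ^^ j) v = 0" if "j \<ge> J" for j
    using L1_pow_eq_zero[OF assms(1), of j] assms(2) that by simp
  then show ?thesis
    unfolding opp_mode_def by (intro Sum_any_eq_lessThan) simp
qed

text \<open>
  Taking adjoints one field at a time reverses the order of the fields.
\<close>
lemma form_apply_modes_adjoint:
  assumes "\<And>k. k \<in> set ks \<Longrightarrow> v k \<in> V (q k)"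
  shows "B (apply_modes ks v m) w
    = B vac (foldr (\<lambda>k. opp_mode smul Y \<omega> (q k) (v k) (m k)) (rev ks) w)"
  using assms
proof (induction ks arbitrary: w)
  case (Cons k ks)
  then show ?case using form_invariant[of "v k" "q k" "m k"] by simp
qed simp

text \<open>
  A product of opposite modes as a combination of products of ordinary modes. The
  function \<open>g\<close> chooses the power of \<open>L(1)\<close> for each field.
\<close>
lemma foldr_opp_mode_expand:
  assumes "distinct ks" "\<And>k. k \<in> set ks \<Longrightarrow> v k \<in> V (q k) \<and> q k < int J"
  shows "foldr (\<lambda>k. opp_mode smul Y \<omega> (q k) (v k) (m k)) ks vac
    = (\<Sum>g\<in>PiE (set ks) (\<lambda>_. {..<J}). smul (\<Prod>k\<in>set ks. (-1) powi q k / fact (g k))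
        (apply_modes ks (\<lambda>k. (L 1 ^^ g k) (v k)) (\<lambda>k. 2 * q k - m k - int (g k) - 2)))"
  using assms
proof (induction ks)
  case (Cons p ks)
  have p: "p \<notin> set ks" using Cons.prems by simp
  let ?c = "\<lambda>g. \<Prod>k\<in>set ks. (-1) powi q k / fact (g k) :: complex"
  let ?A = "\<lambda>ks g. apply_modes ks (\<lambda>k. (L 1 ^^ g k) (v k)) (\<lambda>k. 2 * q k - m k - int (g k) - 2)"
  have "foldr (\<lambda>k. opp_mode smul Y \<omega> (q k) (v k) (m k)) (p # ks) vac
     = opp_mode smul Y \<omega> (q p) (v p) (m p) (\<Sum>g\<in>PiE (set ks) (\<lambda>_. {..<J}). smul (?c g) (?A ks g))"
    using Cons by simp
  also have "\<dots> = (\<Sum>j<J. \<Sum>g\<in>PiE (set ks) (\<lambda>_. {..<J}). smul ((-1) powi q p / fact j * ?c g)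
      (Y ((L 1 ^^ j) (v p)) (2 * q p - m p - int j - 2) (?A ks g)))"
    using Cons.prems(2)[of p]
    by (simp add: opp_mode_eq_sum[where J = J] mode_sum_right mode_linear_right scale_sum_right)
  also have "\<dots> = (\<Sum>g\<in>PiE (set ks) (\<lambda>_. {..<J}). \<Sum>j<J. smul ((-1) powi q p / fact j * ?c g)
      (Y ((L 1 ^^ j) (v p)) (2 * q p - m p - int j - 2) (?A ks g)))"
    by (rule sum.swap)
  also have "\<dots> = (\<Sum>g\<in>PiE (set ks) (\<lambda>_. {..<J}). \<Sum>j<J.
      smul (\<Prod>k\<in>set (p # ks). (-1) powi q k / fact ((g(p := j)) k)) (?A (p # ks) (g(p := j))))"
  proof (intro sum.cong refl)
    fix g j
    have "?A ks (g(p := j)) = ?A ks g"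
      by (rule apply_modes_cong) (use p in auto)
    moreover have "(\<Prod>k\<in>set ks. (-1) powi q k / fact ((g(p := j)) k)) = ?c g"
      by (rule prod.cong) (use p in auto)
    ultimately show "smul ((-1) powi q p / fact j * ?c g)
        (Y ((L 1 ^^ j) (v p)) (2 * q p - m p - int j - 2) (?A ks g))
      = smul (\<Prod>k\<in>set (p # ks). (-1) powi q k / fact ((g(p := j)) k)) (?A (p # ks) (g(p := j)))"
      unfolding list.set prod.insert[OF finite_set p] apply_modes_simps by (simp only: fun_upd_same)
  qed
  finally show ?case unfolding list.set sum_PiE_insert[OF p] .
qed simp

text \<open>
  The vector \<open>e\<^bsup>yL(1)\<^esup> (-y\<^bsup>-2\<^esup>)\<^bsup>L(0)\<^esup> v\<close> for \<open>v\<close> of weight \<open>q\<close>, placed at \<open>1/y\<close> in the adjoint of \<open>Y(v,y)\<close>.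
\<close>
definition inverted :: "(nat \<Rightarrow> int) \<Rightarrow> (nat \<Rightarrow> 'v) \<Rightarrow> (nat \<Rightarrow> complex) \<Rightarrow> nat \<Rightarrow> 'v" where
  "inverted q v x k = exp_L1 smul Y \<omega> (x k) (smul ((-1) powi q k * x k powi (- 2 * q k)) (v k))"

text \<open>
  Both sides are sums over mode indices. After expanding the vectors \<open>L(1)\<^sup>j v\<close> on the right
  and substituting \<open>m \<mapsto> 2q - m - j - 2\<close> in each summand, the terms on the right are those of the
  adjoint of the product of modes on the left.
\<close>
lemma correlator_inversion_radial:
  assumes d: "distinct ks" and radial: "sorted_wrt (\<lambda>i j. norm (x i) > norm (x j)) ks"
    and nz: "\<And>k. k \<in> set ks \<Longrightarrow> x k \<noteq> 0"
    and v: "\<And>k. k \<in> set ks \<Longrightarrow> v k \<in> V (q k)"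
  shows "correlator ks v x = correlator (rev ks) (inverted q v x) (\<lambda>k. inverse (x k))"
proof -
  define J where "J = nat (Max (insert 0 (q ` set ks))) + 1"
  have J: "q k < int J" if "k \<in> set ks" for k
  proof -
    have "q k \<le> Max (insert 0 (q ` set ks))" using that by (intro Max_ge) auto
    then show ?thesis unfolding J_def by linarith
  qed
  let ?P = "PiE (set ks) (\<lambda>_. {..<J})"
  let ?S = "PiE (set ks) (\<lambda>_. UNIV :: int set)"
  define r where "r k j = x k ^ j / fact j * ((-1) powi q k * x k powi (- 2 * q k))" for k j
  define w where "w g k = (L 1 ^^ g k) (v k)" for g :: "nat \<Rightarrow> nat" and k
  \<comment> \<open>An involution for fixed \<open>g\<close>; the restriction keeps it inside the extensional functions.\<close>
  define s where "s g m = (\<lambda>k\<in>set ks. 2 * q k - m k - int (g k) - 2)" for g :: "nat \<Rightarrow> nat" and m :: "nat \<Rightarrow> int"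
  have drev: "distinct (rev ks)" using d by simp
  have "correlator (rev ks) (inverted q v x) (\<lambda>k. inverse (x k))
     = correlator (rev ks) (\<lambda>k. \<Sum>j<J. smul (r k j) ((L 1 ^^ j) (v k))) (\<lambda>k. inverse (x k))"
    by (rule correlator_cong) (simp_all only: set_rev inverted_def r_def exp_L1_eq_sum[OF v J])
  also have "\<dots> = (\<Sum>g\<in>?P. (\<Prod>k\<in>set ks. r k (g k)) * correlator (rev ks) (w g) (\<lambda>k. inverse (x k)))"
    unfolding correlator_expand[OF drev] w_def by simp
  finally have rhs: "correlator (rev ks) (inverted q v x) (\<lambda>k. inverse (x k)) = \<dots>" .
  have "sorted_wrt (\<lambda>i j. norm (inverse (x i)) > norm (inverse (x j))) (rev ks)"
    unfolding sorted_wrt_rev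
    by (rule sorted_wrt_mono_rel[OF _ radial]) (use nz in \<open>auto simp: norm_inverse intro!: less_imp_inverse_less\<close>)
  then have "(mode_term (rev ks) (w g) (\<lambda>k. inverse (x k)) has_sum correlator (rev ks) (w g) (\<lambda>k. inverse (x k))) ?S" for g
    using correlator_has_sum[OF drev] by simp
  also have "(mode_term (rev ks) (w g) (\<lambda>k. inverse (x k)) has_sum correlator (rev ks) (w g) (\<lambda>k. inverse (x k))) ?S
    \<longleftrightarrow> ((\<lambda>m. mode_term (rev ks) (w g) (\<lambda>k. inverse (x k)) (s g m)) has_sum correlator (rev ks) (w g) (\<lambda>k. inverse (x k))) ?S" for g
    by (rule has_sum_reindex_bij_betw[symmetric], rule bij_betwI[where g = "s g"])
       (auto simp: s_def PiE_iff extensional_def restrict_def fun_eq_iff)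
  finally have sums: "((\<lambda>m. mode_term (rev ks) (w g) (\<lambda>k. inverse (x k)) (s g m)) has_sum correlator (rev ks) (w g) (\<lambda>k. inverse (x k))) ?S" for g .
  have "((\<lambda>m. \<Sum>g\<in>?P. (\<Prod>k\<in>set ks. r k (g k)) * mode_term (rev ks) (w g) (\<lambda>k. inverse (x k)) (s g m))
      has_sum correlator (rev ks) (inverted q v x) (\<lambda>k. inverse (x k))) ?S"
    unfolding rhs by (intro has_sum_finite_sum has_sum_cmult_right sums)
  also have "(\<lambda>m. \<Sum>g\<in>?P. (\<Prod>k\<in>set ks. r k (g k)) * mode_term (rev ks) (w g) (\<lambda>k. inverse (x k)) (s g m)) = mode_term ks v x"
  proof
    fix m
    let ?A = "\<lambda>g. apply_modes (rev ks) (w g) (\<lambda>k. 2 * q k - m k - int (g k) - 2)"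
    have "mode_term ks v x m = B vac (foldr (\<lambda>k. opp_mode smul Y \<omega> (q k) (v k) (m k)) (rev ks) vac)
        * (\<Prod>k\<in>set ks. x k powi (- m k - 1))"
      unfolding mode_term_def form_vac_commute[of "apply_modes ks v m"]
      using form_apply_modes_adjoint[of ks v q m vac] v by simp
    also have "foldr (\<lambda>k. opp_mode smul Y \<omega> (q k) (v k) (m k)) (rev ks) vac
       = (\<Sum>g\<in>?P. smul (\<Prod>k\<in>set ks. (-1) powi q k / fact (g k)) (?A g))"
      using foldr_opp_mode_expand[OF drev, of v q J m] v J unfolding w_def by simp
    also have "B vac \<dots> * (\<Prod>k\<in>set ks. x k powi (- m k - 1))
       = (\<Sum>g\<in>?P. (\<Prod>k\<in>set ks. (-1) powi q k / fact (g k)) * B vac (?A g) * (\<Prod>k\<in>set ks. x k powi (- m k - 1)))"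
      unfolding form_sum_right form_linear_right sum_distrib_right ..
    also have "\<dots> = (\<Sum>g\<in>?P. (\<Prod>k\<in>set ks. r k (g k)) * mode_term (rev ks) (w g) (\<lambda>k. inverse (x k)) (s g m))"
    proof (rule sum.cong[OF refl])
      fix g
      have "r k (g k) * inverse (x k) powi (- s g m k - 1) = (-1) powi q k / fact (g k) * x k powi (- m k - 1)"
        if "k \<in> set ks" for k
      proof -
        have "inverse (x k) powi (- s g m k - 1) = x k powi (2 * q k - m k - int (g k) - 1)"
        proof -
          have "- (- s g m k - 1) = 2 * q k - m k - int (g k) - 1" using that by (simp add: s_def)
          then show ?thesis unfolding power_int_inverse power_int_minus[symmetric] by (simp only:)
        qed
        moreover have "x k ^ g k * (x k powi (- 2 * q k) * x k powi (2 * q k - m k - int (g k) - 1)) = x k powi (- m k - 1)"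
        proof -
          have "x k powi (int (g k) + (- 2 * q k + (2 * q k - m k - int (g k) - 1)))
             = x k ^ g k * (x k powi (- 2 * q k) * x k powi (2 * q k - m k - int (g k) - 1))"
            using nz[OF that] by (simp only: power_int_add power_int_of_nat simp_thms)
          moreover have "int (g k) + (- 2 * q k + (2 * q k - m k - int (g k) - 1)) = - m k - 1" by simp
          ultimately show ?thesis by (simp only:)
        qed
        ultimately show ?thesis by (simp add: r_def mult_ac)
      qed
      then have "(\<Prod>k\<in>set ks. r k (g k)) * (\<Prod>k\<in>set ks. inverse (x k) powi (- s g m k - 1))
          = (\<Prod>k\<in>set ks. (-1) powi q k / fact (g k)) * (\<Prod>k\<in>set ks. x k powi (- m k - 1))"
        unfolding prod.distrib[symmetric] by (intro prod.cong refl)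
      moreover have "apply_modes (rev ks) (w g) (s g m) = ?A g"
        by (rule apply_modes_cong) (simp_all add: s_def)
      ultimately show "(\<Prod>k\<in>set ks. (-1) powi q k / fact (g k)) * B vac (?A g) * (\<Prod>k\<in>set ks. x k powi (- m k - 1))
         = (\<Prod>k\<in>set ks. r k (g k)) * mode_term (rev ks) (w g) (\<lambda>k. inverse (x k)) (s g m)"
        unfolding mode_term_def by (simp add: mult_ac)
    qed
    finally show "(\<Sum>g\<in>?P. (\<Prod>k\<in>set ks. r k (g k)) * mode_term (rev ks) (w g) (\<lambda>k. inverse (x k)) (s g m)) = mode_term ks v x m"
      by (rule sym)
  qed
  finally show ?thesis
    by (rule has_sum_unique[OF correlator_has_sum[OF d radial, of v]])
qed

text \<open>
  Both sides are rational in \<open>y\<close>, with denominators that do not vanish at distinct nonzero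
  points. It therefore suffices to compare them for radially ordered points, where
  permutation symmetry restores the order of the fields.
\<close>
theorem correlator_inversion:
  assumes v: "\<And>k. k \<in> {1..n} \<Longrightarrow> v k \<in> V (q k)"
    and y: "inj_on y {1..n}" "y \<in> nonzero_points n"
  shows "correlator [1..<Suc n] v y
    = correlator [1..<Suc n] (inverted q v y) (\<lambda>k. inverse (y k))"
proof -
  let ?ks = "[1..<Suc n]"
  let ?D = "{x. inj_on x {1..n}} \<inter> nonzero_points n"
  have set: "set ?ks = {1..n}" by auto
  have coord: "rational_on n ?D (\<lambda>x. x k)" if "k \<in> {1..n}" for k
    by (rule rational_onI[of n "\<lambda>x. x k" "\<lambda>_. 1"])
       (use that in \<open>simp_all add: polynomial_fun_const polynomial_fun_coord\<close>)
  have inv: "rational_on n ?D (\<lambda>x. inverse (x k))" if "k \<in> {1..n}" for k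
    by (rule rational_onI[of n "\<lambda>x. 1" "\<lambda>x. x k"])
       (use that in \<open>simp_all add: polynomial_fun_const polynomial_fun_coord
          nonzero_points_def inverse_eq_divide\<close>)
  have powi: "rational_on n ?D (\<lambda>x. x k powi m)" if k: "k \<in> {1..n}" for k m
    using rational_on_power[OF coord[OF k], of "nat m"] rational_on_power[OF inv[OF k], of "nat (- m)"]
    by (cases "m \<ge> 0") (simp_all add: power_int_def)
  have diff: "rational_on n ?D (\<lambda>x. inverse (inverse (x i) - inverse (x j)))"
    if ij: "i \<in> {1..n}" "j \<in> {1..n}" "i \<noteq> j" for i j
  proof (rule rational_onI[of n "\<lambda>x. x i * x j" "\<lambda>x. x j - x i"])
    fix x assume "x \<in> ?D"
    then have "x i \<noteq> 0" "x j \<noteq> 0" "inj_on x {1..n}"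
      using ij by (simp_all add: nonzero_points_def)
    moreover from this have "x i \<noteq> x j" using ij inj_on_eq_iff[of x "{1..n}" i j] by blast
    ultimately have "x i \<noteq> 0" "x j \<noteq> 0" "x i \<noteq> x j" by blast+
    then show "x j - x i \<noteq> 0 \<and> inverse (inverse (x i) - inverse (x j)) = x i * x j / (x j - x i)"
      by (simp add: field_simps)
  qed (use ij in \<open>auto intro!: polynomial_fun_mult polynomial_fun_diff polynomial_fun_coord\<close>)
  have vec: "rational_vec n ?D (\<lambda>x. inverted q v x k)" if k: "k \<in> {1..n}" for k
  proof -
    define J where "J = nat (q k) + 1"
    have J: "q k < int J" unfolding J_def by linarith
    show ?thesis
    proof (rule rational_vecI[of "{..<J}"])
      show "rational_on n ?D (\<lambda>x. x k ^ j / fact j * ((-1) powi q k * x k powi (- 2 * q k)))" for j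
        unfolding divide_inverse
        by (intro rational_on_mult rational_on_power coord[OF k] rational_on_const powi[OF k])
      show "inverted q v x k = (\<Sum>j<J. smul (x k ^ j / fact j * ((-1) powi q k * x k powi (- 2 * q k))) ((L 1 ^^ j) (v k)))" for x
        unfolding inverted_def by (rule exp_L1_eq_sum[OF v[OF k] J])
    qed simp
  qed
  show ?thesis
  proof (rule rational_on_unique[where D = ?D and f = "correlator ?ks v"
        and g = "\<lambda>x. correlator ?ks (inverted q v x) (\<lambda>k. inverse (x k))"])
    show "rational_on n ?D (correlator ?ks v)"
      by (rule rational_on_subset[OF correlator_rational_points]) simp
    show "rational_on n ?D (\<lambda>x. correlator ?ks (inverted q v x) (\<lambda>k. inverse (x k)))"
    proof (rule correlator_rational)
      show "rational_vec n ?D (\<lambda>x. inverted q v x k)" if "k \<in> set ?ks" for k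
        using that unfolding set by (rule vec)
      show "rational_on n ?D (\<lambda>x. inverse (inverse (x i) - inverse (x j)))"
        if "i \<in> set ?ks" "j \<in> set ?ks" "i \<noteq> j" for i j
        using that unfolding set by (rule diff)
      show "distinct ?ks" by simp
    qed
    show "radially_ordered n \<inter> nonzero_points n \<subseteq> ?D"
    proof
      fix x assume "x \<in> radially_ordered n \<inter> nonzero_points n"
      then show "x \<in> ?D" using radially_ordered_inj[of x n] by simp
    qed
    show "y \<in> ?D" using y by simp
  next
    fix x assume x: "x \<in> radially_ordered n \<inter> nonzero_points n"
    have "sorted_wrt (\<lambda>i j. norm (x i) > norm (x j)) ?ks"
      using x by (auto simp: radially_ordered_def sorted_wrt_iff_nth_less simp del: upt_Suc)
    then have "correlator ?ks v x = correlator (rev ?ks) (inverted q v x) (\<lambda>k. inverse (x k))"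
    proof (rule correlator_inversion_radial[rotated])
      show "x k \<noteq> 0" if "k \<in> set ?ks" for k
        using x that unfolding set nonzero_points_def by simp
      show "v k \<in> V (q k)" if "k \<in> set ?ks" for k
        using that unfolding set by (rule v)
    qed simp
    also have "\<dots> = correlator ?ks (inverted q v x) (\<lambda>k. inverse (x k))"
    proof (rule correlator_rev)
      show "inj_on (\<lambda>k. inverse (x k)) (set ?ks)"
      proof (rule inj_onI)
        fix i j assume "i \<in> set ?ks" "j \<in> set ?ks" "inverse (x i) = inverse (x j)"
        then show "i = j" using inj_onD[OF radially_ordered_inj, of x n i j] x unfolding set by simp
      qed
    qed simp
    finally show "correlator ?ks v x = correlator ?ks (inverted q v x) (\<lambda>k. inverse (x k))" .
  qed
qed

text \<open>
  For \<open>c \<noteq> 0\<close> put \<open>z = y + d/c\<close> and \<open>r = -c\<^sup>2\<close>. Then \<open>\<gamma>y = 1/(rz) + a/c\<close>, so \<open>\<gamma>\<close> is a translation, the scaling by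
  \<open>r\<close>, the inversion and a translation; the factor \<open>r\<^bsup>wt\<^esup>\<close> from the scaling combines with
  \<open>(-1)\<^bsup>wt\<^esup> (rz)\<^bsup>-2wt\<^esup>\<close> from the inversion to \<open>(cz)\<^bsup>-2wt\<^esup>\<close>, where \<open>cz = cy + d\<close>.
\<close>
theorem correlator_moebius:
  assumes v: "\<And>k. k \<in> {1..n} \<Longrightarrow> v k \<in> V (q k)"
    and det: "a * d - b * c = 1"
    and y: "inj_on y {1..n}" "\<And>k. k \<in> {1..n} \<Longrightarrow> c * y k + d \<noteq> 0"
  shows "correlator [1..<Suc n] v y = correlator [1..<Suc n]
      (\<lambda>k. exp_L1 smul Y \<omega> (- c * (c * y k + d)) (smul ((c * y k + d) powi (- 2 * q k)) (v k)))
      (\<lambda>k. (a * y k + b) / (c * y k + d))"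
proof -
  let ?ks = "[1..<Suc n]"
  have set: "set ?ks = {1..n}" by auto
  have dist: "distinct ?ks" by simp
  define Q where "Q = (\<Sum>k\<in>{1..n}. q k)"
  have scale: "correlator ?ks v (\<lambda>k. r * x k) = r powi (- Q) * correlator ?ks v x" if "r \<noteq> 0" for r x
    unfolding Q_def using correlator_scale[of ?ks v q r x] v that unfolding set by simp
  define J where "J k = nat (q k) + 1" for k
  have J: "q k < int (J k)" for k unfolding J_def by linarith
  show ?thesis
  proof (cases "c = 0")
    case True
    then have "d * a = 1" using det by (simp add: mult.commute)
    then have d: "a = inverse d" "d \<noteq> 0" using inverse_unique[of d a] by auto
    define r where "r = d powi (- 2)"
    have r: "r \<noteq> 0" using d by (simp add: r_def)
    have vec: "exp_L1 smul Y \<omega> (- c * (c * y k + d)) (smul ((c * y k + d) powi (- 2 * q k)) (v k))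
        = smul (r powi q k) (v k)" if "k \<in> {1..n}" for k
    proof -
      have "exp_L1 smul Y \<omega> 0 u = u" for u
        unfolding exp_L1_def by (subst Sum_any_eq_single[where a = 0]) auto
      then show ?thesis using True power_int_mult[of d "- 2" "q k"] by (simp add: r_def)
    qed
    have pt: "(a * y k + b) / (c * y k + d) = r * y k + b / d" for k
      using True d by (simp add: r_def power_int_minus power2_eq_square field_simps)
    have "correlator ?ks
      (\<lambda>k. exp_L1 smul Y \<omega> (- c * (c * y k + d)) (smul ((c * y k + d) powi (- 2 * q k)) (v k)))
      (\<lambda>k. (a * y k + b) / (c * y k + d)) = correlator ?ks (\<lambda>k. smul (r powi q k) (v k)) (\<lambda>k. r * y k + b / d)"
      by (rule correlator_cong) (simp_all only: set vec pt)
    also have "\<dots> = r powi Q * (r powi (- Q) * correlator ?ks v y)"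
      unfolding correlator_translate correlator_smul_all[OF dist] scale[OF r] set prod_power_int[OF r] Q_def ..
    also have "\<dots> = correlator ?ks v y"
      using r by (simp add: power_int_minus)
    finally show ?thesis by simp
  next
    case False
    define z where "z k = y k + d / c" for k
    define r where "r = - (c ^ 2)"
    have r: "r \<noteq> 0" using False by (simp add: r_def)
    have cz: "c * y k + d = c * z k" for k using False by (simp add: z_def field_simps)
    have z: "z k \<noteq> 0" if "k \<in> {1..n}" for k
      using y(2)[OF that] unfolding cz by simp
    have rz: "inj_on (\<lambda>k. r * z k) {1..n}" "(\<lambda>k. r * z k) \<in> nonzero_points n"
    proof -
      show "inj_on (\<lambda>k. r * z k) {1..n}"
      proof (rule inj_onI)
        fix i j assume "i \<in> {1..n}" "j \<in> {1..n}" "r * z i = r * z j"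
        then show "i = j" using r inj_onD[OF y(1), of i j] by (simp add: z_def)
      qed
      show "(\<lambda>k. r * z k) \<in> nonzero_points n"
        unfolding nonzero_points_def using r z by simp
    qed
    have vec: "exp_L1 smul Y \<omega> (- c * (c * y k + d)) (smul ((c * y k + d) powi (- 2 * q k)) (v k))
        = smul (r powi q k) (inverted q v (\<lambda>k. r * z k) k)" if k: "k \<in> {1..n}" for k
    proof -
      have "(c * z k) powi (- 2 * q k) = r powi q k * ((-1) powi q k * (r * z k) powi (- 2 * q k))"
      proof -
        have square: "(x ^ 2) powi (- q k) = x powi (- 2 * q k)" for x :: complex
          using power_int_mult[of x 2 "- q k"] by simp
        have "r powi q k * (-1) powi q k = (c ^ 2) powi q k"
          unfolding power_int_mult_distrib[symmetric] by (simp add: r_def)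
        moreover have "(r * z k) powi (- 2 * q k) = (c ^ 2) powi (- q k) * (c * z k) powi (- 2 * q k)"
          unfolding square[symmetric] power_int_mult_distrib[symmetric]
          by (simp add: r_def power2_eq_square mult_ac)
        moreover have "(c ^ 2) powi q k * (c ^ 2) powi (- q k) = 1"
          using False by (simp add: power_int_minus)
        ultimately show ?thesis by (simp only: mult.assoc[symmetric] mult_1)
      qed
      moreover have "- c * (c * z k) = r * z k" by (simp add: r_def power2_eq_square)
      moreover have "exp_L1 smul Y \<omega> s (smul (r powi q k * t) (v k))
          = smul (r powi q k) (exp_L1 smul Y \<omega> s (smul t (v k)))" for s t
        unfolding exp_L1_eq_sum[OF v[OF k] J] scale_sum_right scale_scale
        by (intro sum.cong refl) (simp only: mult.left_commute)
      ultimately show ?thesis unfolding cz inverted_def by (simp only:)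
    qed
    have pt: "(a * y k + b) / (c * y k + d) = inverse (r * z k) + a / c" if "k \<in> {1..n}" for k
    proof -
      have numerator: "a * y k + b = a * z k - 1 / c"
        using det False by (simp add: z_def field_simps)
      show ?thesis unfolding cz numerator using False z[OF that]
        by (simp add: r_def power2_eq_square field_simps)
    qed
    have "correlator ?ks
      (\<lambda>k. exp_L1 smul Y \<omega> (- c * (c * y k + d)) (smul ((c * y k + d) powi (- 2 * q k)) (v k)))
      (\<lambda>k. (a * y k + b) / (c * y k + d))
      = correlator ?ks (\<lambda>k. smul (r powi q k) (inverted q v (\<lambda>k. r * z k) k)) (\<lambda>k. inverse (r * z k) + a / c)"
      by (rule correlator_cong) (simp_all only: set vec pt)
    also have "\<dots> = r powi Q * correlator ?ks (inverted q v (\<lambda>k. r * z k)) (\<lambda>k. inverse (r * z k))"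
      unfolding correlator_translate correlator_smul_all[OF dist] set prod_power_int[OF r] Q_def ..
    also have "\<dots> = r powi Q * correlator ?ks v (\<lambda>k. r * z k)"
      using correlator_inversion[OF v rz] by simp
    also have "\<dots> = correlator ?ks v z"
      unfolding scale[OF r] using r by (simp add: power_int_minus)
    also have "\<dots> = correlator ?ks v y"
      unfolding z_def by (rule correlator_translate)
    finally show ?thesis by simp
  qed
qed

end

theorem proposition3p2:
  fixes smul :: "complex \<Rightarrow> 'v::ab_group_add \<Rightarrow> 'v"
    and Y :: "'v \<Rightarrow> int \<Rightarrow> 'v \<Rightarrow> 'v"
    and vac \<omega> :: 'v
    and B :: "'v \<Rightarrow> 'v \<Rightarrow> complex"
    and n :: nat and v :: "nat \<Rightarrow> 'v" and wt :: "nat \<Rightarrow> int" and y :: "nat \<Rightarrow> complex"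
    and a b c d :: complex
  assumes "vertex_operator_algebra smul Y vac \<omega>"
    and "simple_voa smul Y vac"
    and "strong_cft_type smul Y vac \<omega>"
    and "iso_to_contragredient smul Y \<omega>"
    and "normalized_invariant_form smul Y vac \<omega> B"
    and "\<And>k. k \<in> {1..n} \<Longrightarrow> v k \<in> wt_space smul Y \<omega> (wt k)"
    and "a * d - b * c = 1"
    and "inj_on y {1..n}"
    and "\<And>k. k \<in> {1..n} \<Longrightarrow> c * y k + d \<noteq> 0"
  shows "Z0 Y vac B n v y =
    Z0 Y vac B n
      (\<lambda>k. exp_L1 smul Y \<omega> (- c * (c * y k + d)) (smul ((c * y k + d) powi (- 2 * wt k)) (v k)))
      (\<lambda>k. (a * y k + b) / (c * y k + d))"
proof -
  interpret cft_voa smul Y vac \<omega> B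
    by (intro cft_voa.intro cft_voa_axioms.intro assms(1,3,5))
  have "inj_on (\<lambda>k. (a * y k + b) / (c * y k + d)) {1..n}"
  proof (rule inj_onI)
    fix i j assume ij: "i \<in> {1..n}" "j \<in> {1..n}"
      and "(a * y i + b) / (c * y i + d) = (a * y j + b) / (c * y j + d)"
    then have "(a * y i + b) * (c * y j + d) = (a * y j + b) * (c * y i + d)"
      using frac_eq_eq[OF assms(9)[OF ij(1)] assms(9)[OF ij(2)]] by blast
    moreover have "(a * d - b * c) * (y i - y j)
        = (a * y i + b) * (c * y j + d) - (a * y j + b) * (c * y i + d)"
      by (simp add: algebra_simps)
    ultimately have "(a * d - b * c) * (y i - y j) = 0" by (simp only: diff_self)
    then have "y i = y j" using assms(7) by simp
    then show "i = j" using inj_onD[OF assms(8)] ij by blast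
  qed
  from Z0_eq_correlator[OF this] Z0_eq_correlator[OF assms(8)] show ?thesis
    using correlator_moebius[OF assms(6,7,8,9)] by (simp only:)
qed

end
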